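(* Let $N=2g+1$ be odd, let $\alpha_1,\dots,\alpha_N\in\mathbb{C}$ be distinct, and put $\mathfrak{A}(\lambda)=\prod_{i=1}^N(\lambda-\alpha_i)$. (a) The algebraic functions $\phi(\lambda)$ admitting an $N$-periodic $\alpha$-fraction expansion $\phi=[b_0;\overline{b_1,\dots,b_N}]_\alpha$ have the form $\phi=\frac{-B+\sqrt{R}}{A}$, satisfying $A\phi^2+2B\phi+C=0$, with polynomials $A,B,C\in\mathbb{C}[\lambda]$ satisfying the following conditions: (1) $\deg B\le g$, and $A$ and $C$ are monic and anti-monic polynomials of degree $g$ and $g+1$ respectively; (2) the discriminant $R=B^2-AC$ is $\alpha$-admissible, i.e. $R=S^2+\mathfrak{A}$ for some polynomial $S$ of degree $g$ or less. (b) Conversely, for an open dense subset of such triples $(A,B,C)$ the corresponding function $\phi=\frac{-B+\sqrt{R}}{A}$ has exactly two $N$-periodic $\alpha$-fraction expansions. The corresponding $b_i$ are rational functions of both the coefficients of $A,B,C$ and the parameters $\alpha_i$, and can be found by an effective matrix factorisation procedure. (c) In the pure periodic case (expansions with $b_N=b_0$) the only additional requirement is $C(\alpha_N)=0$, under which the pure periodic $\alpha$-fraction expansion is generically unique.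
   Context: A polynomial is monic if its highest coefficient is $1$ and anti-monic if its highest coefficient is $-1$. Given $\alpha=(\alpha_1,\dots,\alpha_N)$, extended by $\alpha_{i+N}=\alpha_i$, and $b_0,b_1,\dots,b_N\in\mathbb{C}$ with $b_{i+N}=b_i$ for $i\ge1$, the $N$-periodic $\alpha$-fraction $[b_0;\overline{b_1,\dots,b_N}]_\alpha$ is the formal continued fraction $$b_0+\cfrac{\lambda-\alpha_1}{b_1+\cfrac{\lambda-\alpha_2}{b_2+\ddots}}.$$ Convergence is not considered. Periodicity is interpreted formally: $\phi=[b_0;\overline{b_1,\dots,b_N}]_\alpha$ (one says that $\phi$ admits, or has, this expansion) means that the algebraic function $\phi$ is a fixed point of $s=s_0\circ s_1\circ\dots\circ s_N$, where $s_0(\phi)=b_0+\phi$, $s_k(\phi)=\frac{\lambda-\alpha_k}{b_k+\phi}$ for $1\le k\le N-1$, and $s_N(\phi)=\frac{\lambda-\alpha_N}{b_N-b_0+\phi}$. This is a quadratic equation for $\phi$ over $\mathbb{C}(\lambda)$, and $\phi$ is regarded as an element of $\mathbb{C}(\lambda,\sqrt{R(\lambda)})$. The fraction is called pure $N$-periodic if $b_N=b_0$. Matrix factorisation procedure: for a polynomial $T$ of degree at most $g$ with $T^2=R-\mathfrak{A}$, set $$M_0=\begin{bmatrix} T-B & -C \\ A & T+B \end{bmatrix}.$$ For $k=1,\dots,N$, let $\begin{pmatrix} 1 \\ -b_{k-1} \end{pmatrix}$ be a null vector of the transpose of $M_{k-1}(\alpha_k)$ and put $M_k=\begin{bmatrix}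 b_{k-1} & \lambda-\alpha_k \\ 1 & 0 \end{bmatrix}^{-1}M_{k-1}$. Finally $b_N$ is read off from $M_N=\begin{bmatrix} 1 & b_N-b_0 \\ 0 & 1 \end{bmatrix}$.
   Formalization: The b_i are shown to be rational in the coefficients of A, B, C, the α_i and also the coefficients of a square root T of R−𝔄 (deg T ≤ g): without T this fails, e.g. for g=0, A=1, B=β, C=γ−λ one has b_1=±2√(β²−γ+α_1). *)

theory Defs
  imports "HOL-Analysis.Analysis" "HOL-Algebra.Algebraic_Closure_Type"
    "HOL-Computational_Algebra.Computational_Algebra"
begin

text \<open>
  Algebraic functions of \<open>\<lambda>\<close> are elements of the algebraic closure of \<open>\<complex>(\<lambda>)\<close>. No branch of a
  square root is singled out: \<open>\<surd>R\<close> is any element \<open>r\<close> with \<open>r\<^sup>2 = R\<close>.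
\<close>

type_synonym alg_fun = "complex poly fract alg_closure"

definition of_cpoly :: "complex poly \<Rightarrow> alg_fun" where
  "of_cpoly p = to_ac (Fract p 1)"

definition lin :: "complex \<Rightarrow> complex poly" where
  "lin a = [:- a, 1:]"

text \<open>
  The sequences \<open>\<alpha>\<close> and \<open>b\<close> are extended periodically, so that they are determined by
  \<open>\<alpha>\<^sub>1, \<dots>, \<alpha>\<^sub>N\<close> and \<open>b\<^sub>0, b\<^sub>1, \<dots>, b\<^sub>N\<close>; \<open>b\<^sub>0\<close> is exempt from periodicity.
\<close>

definition alpha_seq :: "nat \<Rightarrow> (nat \<Rightarrow> complex) \<Rightarrow> bool" where
  "alpha_seq N \<alpha> \<longleftrightarrow> (\<forall>i. \<alpha> (i + N) = \<alpha> i) \<and> inj_on \<alpha> {1..N}"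

definition periodic_coeffs :: "nat \<Rightarrow> (nat \<Rightarrow> complex) \<Rightarrow> bool" where
  "periodic_coeffs N b \<longleftrightarrow> (\<forall>i\<ge>1. b (i + N) = b i)"

text \<open>
  The maps \<open>s\<^sub>k\<close> are linear fractional transformations of the projective line, here \<^typ>\<open>alg_fun option\<close>
  with \<^term>\<open>None\<close> as the point at infinity; this avoids the convention \<open>x / 0 = 0\<close>, which would
  produce spurious fixed points.
\<close>

fun translate :: "alg_fun \<Rightarrow> alg_fun option \<Rightarrow> alg_fun option" where
  "translate c None = None"
| "translate c (Some x) = Some (c + x)"

fun divide_into :: "alg_fun \<Rightarrow> alg_fun option \<Rightarrow> alg_fun option" where
  "divide_into u None = Some 0"
| "divide_into u (Some x) = (if x = 0 then None else Some (u / x))"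

definition s_map ::
    "nat \<Rightarrow> (nat \<Rightarrow> complex) \<Rightarrow> (nat \<Rightarrow> complex) \<Rightarrow> nat \<Rightarrow> alg_fun option \<Rightarrow> alg_fun option" where
  "s_map N \<alpha> b k =
     (if k = 0 then translate (of_cpoly [:b 0:])
      else if k < N then divide_into (of_cpoly (lin (\<alpha> k))) \<circ> translate (of_cpoly [:b k:])
      else divide_into (of_cpoly (lin (\<alpha> N))) \<circ> translate (of_cpoly [:b N - b 0:]))"

definition s_comp ::
    "nat \<Rightarrow> (nat \<Rightarrow> complex) \<Rightarrow> (nat \<Rightarrow> complex) \<Rightarrow> alg_fun option \<Rightarrow> alg_fun option" where
  "s_comp N \<alpha> b = foldr (\<circ>) (map (s_map N \<alpha> b) [0..<Suc N]) id"

definition has_expansion ::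
    "nat \<Rightarrow> (nat \<Rightarrow> complex) \<Rightarrow> (nat \<Rightarrow> complex) \<Rightarrow> alg_fun \<Rightarrow> bool" where
  "has_expansion N \<alpha> b \<phi> \<longleftrightarrow> periodic_coeffs N b \<and> s_comp N \<alpha> b (Some \<phi>) = Some \<phi>"

definition has_pure_expansion ::
    "nat \<Rightarrow> (nat \<Rightarrow> complex) \<Rightarrow> (nat \<Rightarrow> complex) \<Rightarrow> alg_fun \<Rightarrow> bool" where
  "has_pure_expansion N \<alpha> b \<phi> \<longleftrightarrow> has_expansion N \<alpha> b \<phi> \<and> b N = b 0"

definition alpha_poly :: "nat \<Rightarrow> (nat \<Rightarrow> complex) \<Rightarrow> complex poly" where
  "alpha_poly N \<alpha> = (\<Prod>i=1..N. lin (\<alpha> i))"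

type_synonym triple = "complex poly \<times> complex poly \<times> complex poly"

fun discr :: "triple \<Rightarrow> complex poly" where
  "discr (A, B, C) = B ^ 2 - A * C"

definition alpha_admissible :: "nat \<Rightarrow> nat \<Rightarrow> (nat \<Rightarrow> complex) \<Rightarrow> complex poly \<Rightarrow> bool" where
  "alpha_admissible g N \<alpha> R \<longleftrightarrow> (\<exists>S. Polynomial.degree S \<le> g \<and> R = S ^ 2 + alpha_poly N \<alpha>)"

definition triples :: "nat \<Rightarrow> nat \<Rightarrow> (nat \<Rightarrow> complex) \<Rightarrow> triple set" where
  "triples g N \<alpha> = {(A, B, C).
     Polynomial.degree B \<le> g \<and> Polynomial.degree A = g \<and> Polynomial.lead_coeff A = 1 \<and>
     Polynomial.degree C = g + 1 \<and> Polynomial.lead_coeff C = - 1 \<and>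
     alpha_admissible g N \<alpha> (discr (A, B, C))}"

text \<open>\<open>\<phi> = (- B + \<surd>R) / A\<close>, for either square root of \<open>R\<close>.\<close>

fun represents :: "triple \<Rightarrow> alg_fun \<Rightarrow> bool" where
  "represents (A, B, C) \<phi> \<longleftrightarrow>
     (\<exists>r. r ^ 2 = of_cpoly (discr (A, B, C)) \<and> \<phi> = (- of_cpoly B + r) / of_cpoly A)"

text \<open>
  Sets of triples carry the topology of coefficientwise convergence. As the degrees are bounded, this
  is the subspace topology of a finite-dimensional complex coefficient space.
\<close>

definition coeff_topology :: "triple set \<Rightarrow> triple topology" where
  "coeff_topology V =
     pullback_topology V (\<lambda>(A, B, C). (poly.coeff A, poly.coeff B, poly.coeff C)) euclidean"

definition open_dense_in :: "triple set \<Rightarrow> triple set \<Rightarrow> bool" where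
  "open_dense_in U V \<longleftrightarrow> openin (coeff_topology V) U \<and> coeff_topology V closure_of U = V"

text \<open>
  The factorisation procedure, started from a square root \<open>T\<close> of \<open>R - \<AA>\<close>. The matrices \<open>M\<^sub>k\<close> have
  polynomial entries; the factor \<open>L\<^sub>k\<close> is invertible only over \<open>\<complex>(\<lambda>)\<close>, so \<open>M\<^sub>k = L\<^sub>k\<^sup>-\<^sup>1 M\<^sub>k\<^sub>-\<^sub>1\<close> is written
  \<open>L\<^sub>k M\<^sub>k = M\<^sub>k\<^sub>-\<^sub>1\<close>.
\<close>

fun start_matrix :: "triple \<Rightarrow> complex poly \<Rightarrow> complex poly ^ 2 ^ 2" where
  "start_matrix (A, B, C) T = vector [vector [T - B, - C], vector [A, T + B]]"

definition step_matrix :: "complex \<Rightarrow> complex \<Rightarrow> complex poly ^ 2 ^ 2" where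
  "step_matrix b a = vector [vector [[:b:], lin a], vector [1, 0]]"

definition procedure_root ::
    "nat \<Rightarrow> nat \<Rightarrow> (nat \<Rightarrow> complex) \<Rightarrow> triple \<Rightarrow> complex poly \<Rightarrow> bool" where
  "procedure_root g N \<alpha> t T \<longleftrightarrow> Polynomial.degree T \<le> g \<and> T ^ 2 = discr t - alpha_poly N \<alpha>"

definition procedure_output ::
    "nat \<Rightarrow> (nat \<Rightarrow> complex) \<Rightarrow> triple \<Rightarrow> complex poly \<Rightarrow> (nat \<Rightarrow> complex) \<Rightarrow> bool" where
  "procedure_output N \<alpha> t T b \<longleftrightarrow> periodic_coeffs N b \<and>
     (\<exists>M :: nat \<Rightarrow> complex poly ^ 2 ^ 2.
        M 0 = start_matrix t T \<and>
        (\<forall>k\<in>{1..N}.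
           transpose (map_matrix (\<lambda>p. poly p (\<alpha> k)) (M (k - 1))) *v vector [1, - b (k - 1)] = 0 \<and>
           step_matrix (b (k - 1)) (\<alpha> k) ** M k = M (k - 1)) \<and>
        M N = vector [vector [1, [:b N - b 0:]], vector [0, 1]])"

text \<open>
  Polynomial functions of the coefficients of \<open>A\<close>, \<open>B\<close>, \<open>C\<close>, \<open>T\<close> and of the \<open>\<alpha>\<^sub>i\<close>. A rational function
  is a quotient of two of them. The coefficients of \<open>T\<close> have to be among the variables: they are
  determined by \<open>A\<close>, \<open>B\<close>, \<open>C\<close> and \<open>\<alpha>\<close> only up to a common sign, and algebraically but not rationally
  (for \<open>N = 1\<close>, \<open>B = \<beta>\<close>, \<open>C = \<gamma> - \<lambda>\<close> one has \<open>b\<^sub>1 = 2T\<close> with \<open>T\<^sup>2 = \<beta>\<^sup>2 - \<gamma> + \<alpha>\<^sub>1\<close>). The two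
  expansions arise from the same rational functions evaluated at \<open>T\<close> and \<open>- T\<close>.
\<close>

datatype coord = Coord_A nat | Coord_B nat | Coord_C nat | Coord_T nat | Coord_alpha nat

fun coord_values :: "(nat \<Rightarrow> complex) \<Rightarrow> triple \<Rightarrow> complex poly \<Rightarrow> coord \<Rightarrow> complex" where
  "coord_values \<alpha> (A, B, C) T (Coord_A i) = poly.coeff A i"
| "coord_values \<alpha> (A, B, C) T (Coord_B i) = poly.coeff B i"
| "coord_values \<alpha> (A, B, C) T (Coord_C i) = poly.coeff C i"
| "coord_values \<alpha> (A, B, C) T (Coord_T i) = poly.coeff T i"
| "coord_values \<alpha> (A, B, C) T (Coord_alpha i) = \<alpha> i"

inductive polynomial_fun :: "((coord \<Rightarrow> complex) \<Rightarrow> complex) \<Rightarrow> bool" where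
  const: "polynomial_fun (\<lambda>x. c)"
| var: "polynomial_fun (\<lambda>x. x v)"
| add: "polynomial_fun p \<Longrightarrow> polynomial_fun q \<Longrightarrow> polynomial_fun (\<lambda>x. p x + q x)"
| mult: "polynomial_fun p \<Longrightarrow> polynomial_fun q \<Longrightarrow> polynomial_fun (\<lambda>x. p x * q x)"

end

(*
  The composition of the maps s_k is a Moebius transformation with matrix
  M = L_1 ... L_N [[1, b_N - b_0], [0, 1]], where L_k has rows (b_{k-1}, lambda - alpha_k) and (1, 0).
  Fixed points of M solve a quadratic equation; writing M = [[T - B, -C], [A, T + B]], the degrees
  of A, B, C, T are read off from the product, and det M = - alpha_poly says B^2 - AC = T^2 + alpha_poly.
  Since this discriminant has odd degree, it is not a square, so phi determines (A, B, C) when A and C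
  are coprime. Then expansions of phi correspond to the two roots T together with a factorisation
  of the start matrix.

  A factorisation exists and is unique once no denominator vanishes. Every matrix of the right shape
  factors after reordering the parameters, because the second row cannot vanish at all remaining alpha_i;
  exchanging neighbours then shows that products in the prescribed order, even generic ones, are dense.
  Openness holds because the roots T stay bounded along convergent sequences of triples.

  At alpha_N the second column of M is b_N - b_0 times the first column, which is not zero. Hence
  b_N = b_0 holds exactly when C(alpha_N) = 0 and T(alpha_N) = - B(alpha_N), which selects one of the two roots.
*)

theory Submission
  imports Defs
begin

text \<open>The density step hides the main obstacle. Knowing that the denominators of the
  factorisation do not vanish identically would give density only if the variety of triples were
  irreducible, and nothing of the kind is established. So every single matrix is approximated, by
  splitting off factors in an order that happens to work and moving them into place. An exchange may
  need a small change of a coefficient, hence the inclusions hold only up to closure.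

  The approximation takes place among matrices, that is among pairs (t, T), and is projected to
  triples afterwards. Three requirements shape it. Both T and -T must be generic for the same
  triple, so density of one condition is combined with openness of the other. In the pure periodic
  case the approximants must be pure themselves, so c = b_N - b_0 stays fixed while the other
  coefficients move. Finally T(\<alpha>_N) \<noteq> 0 is demanded along with the denominators: it
  makes T and -T distinct and, for pure expansions, tells them apart by their value at
  \<alpha>_N.\<close>

text \<open>\<open>(p, q, r, s)\<close> stands for the matrix with rows \<open>(p, q)\<close> and \<open>(r, s)\<close>.\<close>

type_synonym mat2 = "complex poly \<times> complex poly \<times> complex poly \<times> complex poly"

section \<open>Products of step matrices, their degree shape, and splitting off a factor\<close>

fun det2 :: "mat2 \<Rightarrow> complex poly" where
  "det2 (p, q, r, s) = p * s - q * r"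

fun step :: "complex \<Rightarrow> complex \<Rightarrow> mat2 \<Rightarrow> mat2" where
  "step b x (p, q, r, s) = (Polynomial.smult b p + lin x * r, Polynomial.smult b q + lin x * s, p, q)"

fun lprod :: "(complex \<times> complex) list \<Rightarrow> complex \<Rightarrow> mat2" where
  "lprod [] c = (1, [:c:], 0, 1)"
| "lprod ((b, x) # ps) c = step b x (lprod ps c)"

text \<open>
  The row of index \<open>n\<close> is the first row of a product of \<open>n - 1\<close> factors; the index \<open>0\<close> belongs to the
  second row \<open>(0, 1)\<close> of the empty product.
\<close>

definition row_shape :: "nat \<Rightarrow> complex poly \<Rightarrow> complex poly \<Rightarrow> bool" where
  "row_shape n p q \<longleftrightarrow>
     (if even n then poly.coeff q (n div 2) = 1 \<and> (\<forall>i>n div 2. poly.coeff q i = 0) \<and>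
        (\<forall>i\<ge>n div 2. poly.coeff p i = 0)
      else poly.coeff p (n div 2) = 1 \<and> (\<forall>i>n div 2. poly.coeff p i = 0 \<and> poly.coeff q i = 0))"

definition shaped :: "complex list \<Rightarrow> mat2 set" where
  "shaped xs = {(p, q, r, s). row_shape (Suc (length xs)) p q \<and> row_shape (length xs) r s \<and>
     det2 (p, q, r, s) = (\<Prod>x\<leftarrow>xs. - lin x)}"

lemma poly_lin [simp]: "poly (lin a) z = z - a"
  by (simp add: lin_def)

lemma lin_neq_0 [simp]: "lin a \<noteq> 0"
  by (simp add: lin_def)

lemma degree_lin [simp]: "Polynomial.degree (lin a) = 1"
  by (simp add: lin_def)

lemma coeff_lin_mult_Suc:
  "poly.coeff (lin x * f) (Suc i) = poly.coeff f i - x * poly.coeff f (Suc i)"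
  by (simp add: lin_def)

lemma coeff_lin_mult_0: "poly.coeff (lin x * f) 0 = - x * poly.coeff f 0"
  by (simp add: lin_def)

lemma coeff_lin_mult:
  "poly.coeff (lin x * f) i = (if i = 0 then 0 else poly.coeff f (i - 1)) - x * poly.coeff f i"
  by (cases i) (auto simp: coeff_lin_mult_Suc coeff_lin_mult_0)

lemma det2_step: "det2 (step b x M) = - lin x * det2 M"
  by (cases M) (simp add: algebra_simps smult_add_right)

text \<open>The rows obey the recurrence row(n+2) = b * row(n+1) + (\<lambda> - x) * row(n). The
  parity in \<open>row_shape\<close> records which entry carries the leading coefficient 1; it is
  inherited from row(n) through the factor \<lambda> - x.\<close>

lemma row_shape_step:
  assumes "row_shape (Suc n) p q" "row_shape n r s"
  shows "row_shape (Suc (Suc n)) (Polynomial.smult b p + lin x * r) (Polynomial.smult b q + lin x * s)"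
  using assms by (cases "even n") (auto simp: row_shape_def coeff_lin_mult Suc_le_eq elim!: oddE evenE)

lemma step_in_shaped:
  assumes "M \<in> shaped xs"
  shows "step b x M \<in> shaped (x # xs)"
proof -
  obtain p q r s where M: "M = (p, q, r, s)" by (cases M)
  show ?thesis
    using assms row_shape_step[of "length xs" p q r s b x] det2_step[of b x M]
    by (simp add: shaped_def M)
qed

lemma lprod_in_shaped: "lprod ps c \<in> shaped (map snd ps)"
proof (induction ps)
  case Nil
  show ?case
    by (auto simp: shaped_def row_shape_def coeff_pCons split: nat.splits)
next
  case (Cons a ps)
  then show ?case by (cases a) (auto intro: step_in_shaped)
qed

text \<open>Multiplication by a linear factor raises the degree by exactly one; phrased with
  coefficients so that the zero polynomial and the bound m = 0 are covered.\<close>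

lemma lin_mult_coeff_vanish:
  assumes "\<forall>i>m. poly.coeff (lin x * f) i = 0" "i \<ge> m"
  shows "poly.coeff f i = 0"
proof (cases "f = 0")
  case False
  have "Polynomial.degree (lin x * f) = Suc (Polynomial.degree f)"
    using False by (simp add: degree_mult_eq)
  moreover have "Polynomial.degree (lin x * f) \<le> m"
    using assms(1) by (intro degree_le) auto
  ultimately show ?thesis
    using assms(2) by (intro coeff_eq_0) auto
qed auto

text \<open>The recurrence of \<open>row_shape_step\<close> run backwards: the terms with b have too
  low a degree to disturb the leading coefficient of the quotient.\<close>

lemma row_shape_divide:
  assumes "row_shape (Suc (Suc n)) p q" "row_shape (Suc n) r s"
    and "p = Polynomial.smult b r + lin x * r'" "q = Polynomial.smult b s + lin x * s'"
  shows "row_shape n r' s'"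
proof (cases "even n")
  case True
  then obtain j where n: "n = 2 * j" by (elim evenE)
  have q: "poly.coeff q (Suc j) = 1" "\<forall>i>Suc j. poly.coeff q i = 0" "\<forall>i>j. poly.coeff p i = 0"
    and r: "poly.coeff r j = 1" "\<forall>i>j. poly.coeff r i = 0 \<and> poly.coeff s i = 0"
    using assms(1,2) by (auto simp: row_shape_def n Suc_le_eq)
  have "lin x * r' = p - Polynomial.smult b r" "lin x * s' = q - Polynomial.smult b s"
    using assms(3,4) by auto
  then have *: "\<forall>i>j. poly.coeff (lin x * r') i = 0" "\<forall>i>Suc j. poly.coeff (lin x * s') i = 0"
      "poly.coeff (lin x * s') (Suc j) = 1"
    using q r by auto
  have "\<forall>i\<ge>j. poly.coeff r' i = 0" "\<forall>i\<ge>Suc j. poly.coeff s' i = 0"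
    using lin_mult_coeff_vanish *(1,2) by blast+
  moreover have "poly.coeff s' j = 1"
    using *(3) calculation(2) by (simp add: coeff_lin_mult_Suc)
  ultimately show ?thesis
    by (auto simp: row_shape_def n)
next
  case False
  then obtain j where n: "n = 2 * j + 1" by (elim oddE)
  have q: "poly.coeff p (Suc j) = 1" "\<forall>i>Suc j. poly.coeff p i = 0 \<and> poly.coeff q i = 0"
    and r: "\<forall>i>Suc j. poly.coeff s i = 0" "\<forall>i>j. poly.coeff r i = 0"
    using assms(1,2) by (auto simp: row_shape_def n Suc_le_eq)
  have "lin x * r' = p - Polynomial.smult b r" "lin x * s' = q - Polynomial.smult b s"
    using assms(3,4) by auto
  then have *: "\<forall>i>Suc j. poly.coeff (lin x * r') i = 0" "\<forall>i>Suc j. poly.coeff (lin x * s') i = 0"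
      "poly.coeff (lin x * r') (Suc j) = 1"
    using q r by auto
  have "\<forall>i\<ge>Suc j. poly.coeff r' i = 0" "\<forall>i\<ge>Suc j. poly.coeff s' i = 0"
    using lin_mult_coeff_vanish *(1,2) by blast+
  moreover have "poly.coeff r' j = 1"
    using *(3) calculation(1) by (simp add: coeff_lin_mult_Suc)
  ultimately show ?thesis
    by (auto simp: row_shape_def n)
qed

lemma lin_dvd_iff: "lin x dvd f \<longleftrightarrow> poly f x = 0"
  by (simp add: lin_def poly_eq_0_iff_dvd)

lemma singular_row:
  fixes p q r s :: complex
  assumes "p * s - q * r = 0" "r \<noteq> 0 \<or> s \<noteq> 0"
  obtains b where "p = b * r" "q = b * s"
proof (cases "r = 0")
  case True
  then show ?thesis using assms that[of "q / s"] by auto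
next
  case False
  then show ?thesis using assms that[of "p / r"] by (auto simp: field_simps)
qed

lemma prod_list_remove1_map:
  fixes f :: "'a \<Rightarrow> 'b :: comm_monoid_mult"
  assumes "x \<in> set xs"
  shows "(\<Prod>y\<leftarrow>xs. f y) = f x * (\<Prod>y\<leftarrow>remove1 x xs. f y)"
  using assms by (induction xs) (auto simp: ac_simps)

text \<open>The first row minus b times the second vanishes at x, so \<lambda> - x can be divided
  out. The quotient has the old second row on top, and cancelling - (\<lambda> - x) in the
  determinant removes x from the parameters.\<close>

lemma shaped_factor_at:
  assumes M: "(p, q, r, s) \<in> shaped xs" and x: "x \<in> set xs"
    and b: "poly p x = b * poly r x" "poly q x = b * poly s x"
  obtains M' where "M' \<in> shaped (remove1 x xs)" "(p, q, r, s) = step b x M'"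
proof -
  have "lin x dvd p - Polynomial.smult b r" "lin x dvd q - Polynomial.smult b s"
    using b by (auto simp: lin_dvd_iff)
  then obtain r' s' where "p - Polynomial.smult b r = lin x * r'" "q - Polynomial.smult b s = lin x * s'"
    by (auto elim!: dvdE)
  then have rs: "p = Polynomial.smult b r + lin x * r'" "q = Polynomial.smult b s + lin x * s'"
    by (simp_all add: algebra_simps)
  obtain n where n: "length xs = Suc n" using x by (cases xs) auto
  have len: "length (remove1 x xs) = n"
    using x n by (simp add: length_remove1)
  have step: "(p, q, r, s) = step b x (r, s, r', s')"
    by (simp add: rs)
  have "- lin x * det2 (r, s, r', s') = (\<Prod>x\<leftarrow>xs. - lin x)"
    using M det2_step[of b x "(r, s, r', s')"] step by (simp add: shaped_def)
  also have "\<dots> = - lin x * (\<Prod>x\<leftarrow>remove1 x xs. - lin x)"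
    using x by (rule prod_list_remove1_map)
  finally have "det2 (r, s, r', s') = (\<Prod>x\<leftarrow>remove1 x xs. - lin x)"
    by simp
  moreover have "row_shape n r' s'"
    using row_shape_divide[OF _ _ rs, of n] M n by (simp add: shaped_def)
  ultimately have "(r, s, r', s') \<in> shaped (remove1 x xs)"
    using M n len by (simp add: shaped_def)
  then show ?thesis using that step by blast
qed

lemma shaped_det_root:
  assumes "(p, q, r, s) \<in> shaped xs" "x \<in> set xs"
  shows "poly p x * poly s x - poly q x * poly r x = 0"
proof -
  have "poly (det2 (p, q, r, s)) x = poly (\<Prod>x\<leftarrow>xs. - lin x) x"
    using assms(1) by (simp add: shaped_def)
  also have "\<dots> = 0"
    using prod_list_remove1_map[OF assms(2), of "\<lambda>x. - lin x"] by simp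
  finally show ?thesis by simp
qed

lemma shaped_factor:
  assumes M: "M \<in> shaped xs" and xs: "distinct xs" "xs \<noteq> []"
  obtains b x M' where "x \<in> set xs" "M' \<in> shaped (remove1 x xs)" "M = step b x M'"
proof -
  obtain p q r s where M_eq: "M = (p, q, r, s)" by (cases M)
  note M = M[unfolded M_eq]
  obtain n where n: "length xs = Suc n" using xs by (cases xs) auto
  have "\<exists>x\<in>set xs. poly r x \<noteq> 0 \<or> poly s x \<noteq> 0"
  proof (rule ccontr)
    assume "\<not> ?thesis"
    then have roots: "set xs \<subseteq> {x. poly r x = 0}" "set xs \<subseteq> {x. poly s x = 0}" by auto
    \<comment> \<open>\<open>f\<close> is the monic entry of the second row. Its degree, half the
      length of \<open>xs\<close> rounded down, is smaller than the number of distinct points at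
      which it would vanish.\<close>
    define f where "f = (if even (length xs) then s else r)"
    have f: "poly.coeff f (length xs div 2) = 1" "\<forall>i>length xs div 2. poly.coeff f i = 0"
      using M by (auto simp: shaped_def row_shape_def f_def split: if_splits)
    then have "f \<noteq> 0" "Polynomial.degree f \<le> length xs div 2"
      by (auto intro: degree_le)
    moreover have "card (set xs) \<le> card {x. poly f x = 0}"
      using roots poly_roots_finite[OF \<open>f \<noteq> 0\<close>] by (intro card_mono) (auto simp: f_def)
    ultimately show False
      using card_poly_roots_bound[OF \<open>f \<noteq> 0\<close>] distinct_card[OF xs(1)] n by simp
  qed
  then obtain x where x: "x \<in> set xs" "poly r x \<noteq> 0 \<or> poly s x \<noteq> 0" by blast
  obtain b where "poly p x = b * poly r x" "poly q x = b * poly s x"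
    using singular_row[OF shaped_det_root[OF M x(1)] x(2)] .
  then show ?thesis
    using shaped_factor_at[OF M x(1)] that x(1) unfolding M_eq by metis
qed

section \<open>Density of products in the prescribed order\<close>

definition near_poly :: "real \<Rightarrow> complex poly \<Rightarrow> complex poly \<Rightarrow> bool" where
  "near_poly e p q \<longleftrightarrow> (\<forall>i. norm (poly.coeff p i - poly.coeff q i) < e)"

fun near :: "real \<Rightarrow> mat2 \<Rightarrow> mat2 \<Rightarrow> bool" where
  "near e (p, q, r, s) (p', q', r', s') \<longleftrightarrow>
     near_poly e p p' \<and> near_poly e q q' \<and> near_poly e r r' \<and> near_poly e s s'"

text \<open>The closure in the coefficientwise sup norm, written out so that no topology on matrices
  has to be set up.\<close>

definition adherent :: "mat2 set \<Rightarrow> mat2 set" where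
  "adherent S = {M. \<forall>e>0. \<exists>M'\<in>S. near e M' M}"

lemma near_poly_refl: "e > 0 \<Longrightarrow> near_poly e p p"
  by (simp add: near_poly_def)

lemma near_refl: "e > 0 \<Longrightarrow> near e M M"
  by (cases M) (simp add: near_poly_refl)

lemma near_poly_mono: "near_poly d p q \<Longrightarrow> d \<le> e \<Longrightarrow> near_poly e p q"
  unfolding near_poly_def by (meson less_le_trans)

lemma near_poly_trans:
  assumes "near_poly d p q" "near_poly e q r"
  shows "near_poly (d + e) p r"
  unfolding near_poly_def
proof
  fix i
  have "norm (poly.coeff p i - poly.coeff r i) \<le>
      norm (poly.coeff p i - poly.coeff q i) + norm (poly.coeff q i - poly.coeff r i)"
    using norm_triangle_ineq[of "poly.coeff p i - poly.coeff q i" "poly.coeff q i - poly.coeff r i"]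
    by simp
  also have "\<dots> < d + e"
    using assms by (auto simp: near_poly_def intro: add_strict_mono)
  finally show "norm (poly.coeff p i - poly.coeff r i) < d + e" .
qed

lemma near_trans: "near d L M \<Longrightarrow> near e M M' \<Longrightarrow> near (d + e) L M'"
  by (cases L; cases M; cases M') (auto intro: near_poly_trans)

lemma adherentD: "M \<in> adherent S \<Longrightarrow> e > 0 \<Longrightarrow> \<exists>M'\<in>S. near e M' M"
  by (simp add: adherent_def)

lemma subset_adherent: "S \<subseteq> adherent S"
  using near_refl unfolding adherent_def by blast

lemma adherent_weaken: "M \<in> adherent S \<Longrightarrow> S \<subseteq> S' \<Longrightarrow> M \<in> adherent S'"
  unfolding adherent_def by blast

lemma adherent_subset:
  assumes "S \<subseteq> adherent S'"
  shows "adherent S \<subseteq> adherent S'"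
proof
  fix M assume M: "M \<in> adherent S"
  show "M \<in> adherent S'"
    unfolding adherent_def
  proof (intro CollectI allI impI)
    fix e :: real assume "e > 0"
    then have "e / 2 > 0" by simp
    obtain L where L: "L \<in> S" "near (e / 2) L M"
      using adherentD[OF M \<open>e / 2 > 0\<close>] by blast
    obtain L' where "L' \<in> S'" "near (e / 2) L' L"
      using adherentD[OF subsetD[OF assms L(1)] \<open>e / 2 > 0\<close>] by blast
    then show "\<exists>M'\<in>S'. near e M' M"
      using near_trans[OF _ L(2), of "e / 2" L'] by auto
  qed
qed

text \<open>Each coefficient of the new entry combines one coefficient of p and two neighbouring
  ones of r, with weights b, 1 and - x; hence the Lipschitz constant.\<close>

lemma near_poly_step:
  assumes "e > 0" "near_poly e p p'" "near_poly e r r'"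
  shows "near_poly ((norm b + 1 + norm x) * e)
    (Polynomial.smult b p + lin x * r) (Polynomial.smult b p' + lin x * r')"
  unfolding near_poly_def
proof
  fix i
  define u where "u = (if i = 0 then 0 else poly.coeff r (i - 1) - poly.coeff r' (i - 1))"
  let ?d = "poly.coeff p i - poly.coeff p' i" and ?v = "poly.coeff r i - poly.coeff r' i"
  have "norm u < e" "norm ?d < e" "norm ?v < e"
    using assms by (auto simp: near_poly_def u_def)
  have "norm (b * ?d + u - x * ?v) \<le> norm (b * ?d) + norm u + norm (x * ?v)"
    using norm_triangle_ineq4[of "b * ?d + u" "x * ?v"] norm_triangle_ineq[of "b * ?d" u] by linarith
  also have "\<dots> < norm b * e + e + norm x * e"
    using \<open>norm u < e\<close> mult_left_mono[of "norm ?d" e "norm b"] mult_left_mono[of "norm ?v" e "norm x"]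
      \<open>norm ?d < e\<close> \<open>norm ?v < e\<close>
    by (simp add: norm_mult)
  finally have "norm (b * ?d + u - x * ?v) < (norm b + 1 + norm x) * e"
    by (simp add: algebra_simps)
  moreover have "poly.coeff (Polynomial.smult b p + lin x * r) i -
      poly.coeff (Polynomial.smult b p' + lin x * r') i = b * ?d + u - x * ?v"
    unfolding coeff_add coeff_smult coeff_lin_mult u_def by (simp add: algebra_simps)
  ultimately show "norm (poly.coeff (Polynomial.smult b p + lin x * r) i -
      poly.coeff (Polynomial.smult b p' + lin x * r') i) < (norm b + 1 + norm x) * e"
    by simp
qed

lemma near_step:
  assumes "e > 0" "near e M M'"
  shows "near ((norm b + 1 + norm x) * e) (step b x M) (step b x M')"
proof -
  have "e \<le> (norm b + 1 + norm x) * e"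
    using assms(1) by (simp add: algebra_simps)
  then show ?thesis
    using assms by (cases M; cases M') (auto intro: near_poly_step near_poly_mono)
qed

lemma adherent_step:
  assumes "M \<in> adherent S"
  shows "step b x M \<in> adherent (step b x ` S)"
  unfolding adherent_def
proof (intro CollectI allI impI)
  fix e :: real assume e: "e > 0"
  define K where "K = norm b + 1 + norm x"
  have K: "K > 0" unfolding K_def by (simp add: add_pos_nonneg add_nonneg_pos)
  then have "e / K > 0" using e by simp
  then obtain M' where "M' \<in> S" "near (e / K) M' M"
    using adherentD[OF assms] by blast
  then show "\<exists>M'\<in>step b x ` S. near e M' (step b x M)"
    using near_step[of "e / K" M' M b x] K e unfolding K_def[symmetric] by auto
qed

lemma coeffs_bounded:
  fixes p :: "complex poly"
  obtains K where "K > 0" "\<And>i. norm (poly.coeff p i) < K"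
proof
  let ?K = "1 + (\<Sum>i\<le>Polynomial.degree p. norm (poly.coeff p i))"
  have nonneg: "(\<Sum>i\<le>Polynomial.degree p. norm (poly.coeff p i)) \<ge> 0"
    by (intro sum_nonneg) auto
  then show "?K > 0" by linarith
  fix i
  show "norm (poly.coeff p i) < ?K"
  proof (cases "i \<le> Polynomial.degree p")
    case True
    then show ?thesis
      using member_le_sum[of i "{..Polynomial.degree p}" "\<lambda>i. norm (poly.coeff p i)"] by auto
  next
    case False
    then show ?thesis using nonneg by (simp add: coeff_eq_0)
  qed
qed

lemma near_poly_add_smult:
  assumes "\<And>i. norm (poly.coeff p i) < K" "norm (b' - b) * K < e" "e > 0"
  shows "near_poly e (Polynomial.smult b' p + f) (Polynomial.smult b p + f)"
  unfolding near_poly_def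
proof
  fix i
  have "norm (b' - b) * norm (poly.coeff p i) \<le> norm (b' - b) * K"
    using assms(1)[of i] by (intro mult_left_mono) auto
  then show "norm (poly.coeff (Polynomial.smult b' p + f) i
      - poly.coeff (Polynomial.smult b p + f) i) < e"
    using assms(2) by (simp add: norm_mult[symmetric] algebra_simps)
qed

text \<open>A ball around b is infinite and so contains values outside B. The later genericity
  arguments therefore only have to show that finitely many leading coefficients are bad.\<close>

lemma adherent_head:
  assumes "finite B"
  shows "step b x M \<in> adherent {step b' x M | b'. b' \<notin> B}"
  unfolding adherent_def
proof (intro CollectI allI impI)
  fix e :: real assume e: "e > 0"
  obtain p q r s where M: "M = (p, q, r, s)" by (cases M)
  obtain K where K: "K > 0" "\<And>i. norm (poly.coeff p i) < K"
    using coeffs_bounded by blast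
  obtain L where L: "L > 0" "\<And>i. norm (poly.coeff q i) < L"
    using coeffs_bounded by blast
  have "e / (K + L) > 0" using e K L by simp
  then have "\<not> ball b (e / (K + L)) \<subseteq> B"
    using finite_imp_not_open[of "ball b (e / (K + L))"] finite_subset[OF _ assms] by auto
  then obtain b' where "b' \<notin> B" "b' \<in> ball b (e / (K + L))"
    by blast
  then have b': "b' \<notin> B" "norm (b' - b) < e / (K + L)"
    by (auto simp: dist_norm norm_minus_commute)
  have "norm (b' - b) * (K + L) < e"
    using b'(2) K L by (simp add: pos_less_divide_eq)
  moreover have "norm (b' - b) * K \<le> norm (b' - b) * (K + L)"
      "norm (b' - b) * L \<le> norm (b' - b) * (K + L)"
    using K L by (auto intro!: mult_left_mono)
  ultimately have "near e (step b' x M) (step b x M)"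
    using near_poly_add_smult[OF K(2)] near_poly_add_smult[OF L(2)] e
    by (auto simp: M near_poly_refl)
  then show "\<exists>M'\<in>{step b' x M |b'. b' \<notin> B}. near e M' (step b x M)"
    using b'(1) by blast
qed

section \<open>Exchanging neighbouring factors\<close>

fun shift :: "complex \<Rightarrow> mat2 \<Rightarrow> mat2" where
  "shift e (p, q, r, s) = (p + Polynomial.smult e r, q + Polynomial.smult e s, r, s)"

definition lprods :: "complex list \<Rightarrow> mat2 set" where
  "lprods xs = {lprod ps c | ps c. map snd ps = xs}"

lemma lprodsI: "map snd ps = xs \<Longrightarrow> lprod ps c \<in> lprods xs"
  unfolding lprods_def by blast

lemma lprodsE:
  assumes "M \<in> lprods xs"
  obtains ps c where "M = lprod ps c" "map snd ps = xs"
  using assms unfolding lprods_def by blast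

text \<open>\<open>shift e\<close> is left multiplication by the matrix with rows (1, e) and (0, 1).
  It merges with the leading factor, turning b into b + e, or with the final matrix, turning c into
  c + e, if there are no factors.\<close>

lemma shift_lprods:
  assumes "M \<in> lprods xs"
  shows "shift e M \<in> lprods xs"
proof -
  obtain ps c where M: "M = lprod ps c" "map snd ps = xs"
    using assms by (auto simp: lprods_def)
  show ?thesis
  proof (cases ps)
    case Nil
    then have "shift e M = lprod ps (c + e)" by (simp add: M)
    then show ?thesis using M(2) unfolding lprods_def by blast
  next
    case (Cons bx ps')
    obtain b x where bx: "bx = (b, x)" by (cases bx)
    obtain p q r s where "lprod ps' c = (p, q, r, s)" using prod_cases4 by blast
    then have "shift e M = lprod ((b + e, x) # ps') c"
      by (simp add: M Cons bx smult_add_left)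
    then show ?thesis using M(2) Cons bx unfolding lprods_def by fastforce
  qed
qed

lemma step_lprods:
  assumes "M \<in> lprods xs"
  shows "step b x M \<in> lprods (x # xs)"
proof -
  obtain ps c where "M = lprod ps c" "map snd ps = xs"
    using assms by (rule lprodsE)
  then show ?thesis
    using lprodsI[of "(b, x) # ps" "x # xs" c] by simp
qed

lemma lprods_ConsE:
  assumes "L \<in> lprods (x # xs)"
  obtains b M where "L = step b x M" "M \<in> lprods xs"
proof -
  obtain ps c where L: "L = lprod ps c" "map snd ps = x # xs"
    using assms by (rule lprodsE)
  then obtain b ps' where "L = step b x (lprod ps' c)" "map snd ps' = xs"
    by (cases ps) auto
  then show ?thesis
    using lprodsI that by blast
qed

lemma poly_ext:
  fixes p q :: "complex poly"
  assumes "\<And>z. poly p z = poly q z"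
  shows "p = q"
  using assms poly_eq_poly_eq_iff by blast

text \<open>
  A shaped matrix factors for some order of the parameters; this exchange turns it into a limit of
  products in the prescribed order.
\<close>

lemma step_swap:
  assumes "b' \<noteq> 0"
  shows "step b x (step b' y M) =
    step (b + (y - x) / b') y (step b' x (shift ((x - y) / b') M))"
proof -
  obtain p q r s where M: "M = (p, q, r, s)" by (cases M)
  \<comment> \<open>In the products of the two factors the upper left entries are b * b' + \<lambda>
    - x and (b + d) * b' + \<lambda> - y. Equating them forces this d, and the shift by - d then
    repairs the second column.\<close>
  define d where "d = (y - x) / b'"
  have y: "y = x + d * b'" "(y - x) / b' = d" "(x - y) / b' = - d"
    using assms by (simp_all add: d_def field_simps)
  show ?thesis
    unfolding M y(2,3) step.simps shift.simps prod.inject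
    by (intro conjI poly_ext) (simp_all add: y(1) algebra_simps)
qed

text \<open>The exchange divides by the second coefficient b', so a product with b' = 0 is replaced
  by products with nearby nonzero values. This is where the closure enters.\<close>

lemma lprods_swap: "lprods (x # y # xs) \<subseteq> adherent (lprods (y # x # xs))"
proof
  fix L assume "L \<in> lprods (x # y # xs)"
  then obtain b M' where "L = step b x M'" "M' \<in> lprods (y # xs)"
    by (rule lprods_ConsE)
  then obtain b' M where L: "L = step b x (step b' y M)" "M \<in> lprods xs"
    by (metis lprods_ConsE)
  have "step b x (step b'' y M) \<in> lprods (y # x # xs)" if "b'' \<noteq> 0" for b''
    unfolding step_swap[OF that, of b x y M] by (intro step_lprods shift_lprods L)
  then have sub: "step b x ` {step b'' y M | b''. b'' \<notin> {0}} \<subseteq> lprods (y # x # xs)"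
    by auto
  have "L \<in> adherent (step b x ` {step b'' y M | b''. b'' \<notin> {0}})"
    unfolding L(1) by (rule adherent_step[OF adherent_head]) simp
  then show "L \<in> adherent (lprods (y # x # xs))"
    using sub by (rule adherent_weaken)
qed

lemma lprods_Cons_adherent:
  assumes "S \<subseteq> adherent (lprods ys)" "M \<in> S"
  shows "step b x M \<in> adherent (lprods (x # ys))"
proof -
  have "step b x M \<in> adherent (step b x ` lprods ys)"
    using assms by (intro adherent_step) auto
  moreover have "step b x ` lprods ys \<subseteq> lprods (x # ys)"
    using step_lprods by blast
  ultimately show ?thesis by (rule adherent_weaken)
qed

text \<open>Carries x from the front to its place in \<open>xs\<close> by exchanging it with one
  parameter after another; \<open>adherent_subset\<close> absorbs the closures that
  accumulate.\<close>

lemma lprods_move_front: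
  assumes "x \<in> set xs"
  shows "lprods (x # remove1 x xs) \<subseteq> adherent (lprods xs)"
  using assms
proof (induction xs)
  case (Cons y ys)
  show ?case
  proof (cases "y = x")
    case False
    then have IH: "lprods (x # remove1 x ys) \<subseteq> adherent (lprods ys)"
      using Cons by auto
    have "lprods (y # x # remove1 x ys) \<subseteq> adherent (lprods (y # ys))"
    proof
      fix L assume "L \<in> lprods (y # x # remove1 x ys)"
      then obtain b M where "L = step b y M" "M \<in> lprods (x # remove1 x ys)"
        by (rule lprods_ConsE)
      then show "L \<in> adherent (lprods (y # ys))"
        using lprods_Cons_adherent[OF IH] by blast
    qed
    then have "lprods (x # y # remove1 x ys) \<subseteq> adherent (lprods (y # ys))"
      by (rule subset_trans[OF lprods_swap adherent_subset])
    then show ?thesis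
      using False by simp
  qed (simp add: subset_adherent)
qed auto

lemma shaped_NilE:
  assumes "M \<in> shaped []"
  obtains c where "M = lprod [] c"
proof -
  obtain p q r s where M: "M = (p, q, r, s)" by (cases M)
  have *: "row_shape (Suc 0) p q" "row_shape 0 r s"
    using assms by (simp_all add: shaped_def M)
  have "p = 1" "q = [:poly.coeff q 0:]" "r = 0" "s = 1"
    using * by (auto simp: row_shape_def poly_eq_iff coeff_pCons split: nat.splits)
  then show ?thesis using that[of "poly.coeff q 0"] by (simp add: M)
qed

lemma shaped_subset_adherent:
  assumes "distinct xs"
  shows "shaped xs \<subseteq> adherent (lprods xs)"
  using assms
proof (induction "length xs" arbitrary: xs)
  case 0
  have "shaped [] \<subseteq> lprods []"
    by (metis shaped_NilE lprodsI list.simps(8) subsetI)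
  then show ?case using 0 subset_adherent by auto
next
  case (Suc n)
  show ?case
  proof
    fix M assume "M \<in> shaped xs"
    then obtain b x M' where x: "x \<in> set xs" "M' \<in> shaped (remove1 x xs)" "M = step b x M'"
      using shaped_factor Suc by (metis list.size(3) nat.distinct(1))
    have "shaped (remove1 x xs) \<subseteq> adherent (lprods (remove1 x xs))"
      using Suc x(1) by (intro Suc(1)) (auto simp: length_remove1)
    then have "M \<in> adherent (lprods (x # remove1 x xs))"
      unfolding x(3) using x(2) by (rule lprods_Cons_adherent)
    then show "M \<in> adherent (lprods xs)"
      using subsetD[OF adherent_subset[OF lprods_move_front[OF x(1)]]] by simp
  qed
qed

section \<open>Generic products\<close>

text \<open>
  Each condition excludes finitely many values of the leading coefficient, whatever the others are. For
  \<open>F\<close> containing all parameters, no denominator of the factorisation procedure vanishes.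
\<close>

fun generic :: "complex set \<Rightarrow> (complex \<times> complex) list \<Rightarrow> complex \<Rightarrow> bool" where
  "generic F [] c \<longleftrightarrow> True"
| "generic F (bx # ps) c \<longleftrightarrow>
     generic F ps c \<and> (\<forall>\<rho>\<in>F. poly (fst (lprod (bx # ps) c)) \<rho> \<noteq> 0)"

lemma generic_first_entry:
  "generic F ps c \<Longrightarrow> \<rho> \<in> F \<Longrightarrow> poly (fst (lprod ps c)) \<rho> \<noteq> 0"
  by (cases ps) auto

lemma generic_drop: "generic F ps c \<Longrightarrow> generic F (drop k ps) c"
  by (induction ps arbitrary: k) (auto split: nat.splits simp: drop_Cons)

lemma finite_linear_roots:
  fixes u w :: complex
  shows "u \<noteq> 0 \<Longrightarrow> finite {b. b * u + w = 0}"
  by (rule finite_subset[of _ "{- w / u}"]) (auto simp: field_simps add_eq_0_iff2)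

text \<open>At each \<rho> in F the new first entry is linear in b, with slope the old first entry,
  which genericity of the tail keeps nonzero. So each \<rho> excludes a single b.\<close>

lemma finite_bad_generic:
  assumes "finite F" "generic F ps c"
  shows "finite {b. \<not> generic F ((b, x) # ps) c}"
proof -
  obtain p q r s where M: "lprod ps c = (p, q, r, s)" using prod_cases4 by blast
  have "finite (\<Union>\<rho>\<in>F. {b. b * poly p \<rho> + (\<rho> - x) * poly r \<rho> = 0})"
    using assms generic_first_entry[OF assms(2)] by (intro finite_UN_I finite_linear_roots) (auto simp: M)
  then show ?thesis
    by (rule rev_finite_subset) (use assms in \<open>auto simp: M\<close>)
qed

text \<open>Only the coefficients b move; c is the same on both sides, because the pure periodic
  case needs approximants with c = 0.\<close>

lemma adherent_generic:
  assumes "finite F"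
  shows "lprod ps c \<in> adherent {lprod ps' c | ps'. map snd ps' = map snd ps \<and> generic F ps' c}"
proof (induction ps)
  case Nil
  have "lprod [] c \<in> {lprod ps' c | ps'. map snd ps' = map snd [] \<and> generic F ps' c}"
    by force
  then show ?case by (rule subsetD[OF subset_adherent])
next
  case (Cons bx ps)
  obtain b x where bx: "bx = (b, x)" by (cases bx)
  let ?S = "{lprod ps' c | ps'. map snd ps' = map snd ps \<and> generic F ps' c}"
  let ?S' = "{lprod ps' c | ps'. map snd ps' = map snd (bx # ps) \<and> generic F ps' c}"
  have sub: "step b x ` ?S \<subseteq> adherent ?S'"
  proof
    fix L assume "L \<in> step b x ` ?S"
    then obtain ps' where L: "L = step b x (lprod ps' c)"
      and ps': "map snd ps' = map snd ps" "generic F ps' c"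
      by blast
    let ?B = "{b. \<not> generic F ((b, x) # ps') c}"
    have "step b x (lprod ps' c) \<in> adherent {step b' x (lprod ps' c) | b'. b' \<notin> ?B}"
      using finite_bad_generic[OF assms ps'(2)] by (rule adherent_head)
    moreover have "{step b' x (lprod ps' c) | b'. b' \<notin> ?B} \<subseteq> ?S'"
    proof
      fix L assume "L \<in> {step b' x (lprod ps' c) | b'. b' \<notin> ?B}"
      then obtain b' where "L = step b' x (lprod ps' c)" "generic F ((b', x) # ps') c"
        by blast
      then have "L = lprod ((b', x) # ps') c" "generic F ((b', x) # ps') c"
          "map snd ((b', x) # ps') = map snd (bx # ps)"
        using ps'(1) bx by simp_all
      then show "L \<in> ?S'" by blast
    qed
    ultimately show "L \<in> adherent ?S'"
      unfolding L
      by (rule adherent_weaken)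
  qed
  have "step b x (lprod ps c) \<in> adherent ?S'"
    by (rule subsetD[OF adherent_subset[OF sub] adherent_step[OF Cons]])
  then show ?case by (simp add: bx)
qed

text \<open>For a start matrix this says that A and C have no common root and that T(z) \<noteq> 0,
  since r = A, q = - C and p + s = 2 * T.\<close>

definition nondegenerate :: "complex \<Rightarrow> mat2 \<Rightarrow> bool" where
  "nondegenerate z = (\<lambda>(p, q, r, s).
     (\<forall>\<rho>. poly r \<rho> = 0 \<longrightarrow> poly q \<rho> \<noteq> 0) \<and> poly (p + s) z \<noteq> 0)"

text \<open>After one more step the lower left entry is p and the upper right one is b * q +
  (\<lambda> - x) * s. A common root of p and q would be a root of the determinant, hence a
  parameter, where genericity forbids p to vanish. So each root of p excludes just one b, and so
  does the trace at z.\<close>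

lemma finite_bad_nondegenerate:
  assumes gen: "generic F ps c" and F: "set (map snd ps) \<subseteq> F" "z \<in> F"
  shows "finite {b. \<not> nondegenerate z (lprod ((b, x) # ps) c)}"
proof -
  obtain p q r s where M: "lprod ps c = (p, q, r, s)" using prod_cases4 by blast
  have pz: "poly p \<rho> \<noteq> 0" if "\<rho> \<in> F" for \<rho>
    using generic_first_entry[OF gen that] by (simp add: M)
  have q: "poly q \<rho> \<noteq> 0" if "poly p \<rho> = 0" for \<rho>
  proof
    assume "poly q \<rho> = 0"
    then have "poly (det2 (p, q, r, s)) \<rho> = 0" using that by simp
    moreover have "det2 (p, q, r, s) = (\<Prod>x\<leftarrow>map snd ps. - lin x)"
      using lprod_in_shaped[of ps c] unfolding M by (simp add: shaped_def)
    ultimately have "poly (\<Prod>x\<leftarrow>map snd ps. - lin x) \<rho> = 0" by metis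
    then have "\<rho> \<in> set (map snd ps)"
      by (induction ps) auto
    then show False using F(1) pz that by blast
  qed
  have "p \<noteq> 0" using pz[OF F(2)] by auto
  then have "finite (\<Union>\<rho>\<in>{\<rho>. poly p \<rho> = 0}. {b. b * poly q \<rho> + (\<rho> - x) * poly s \<rho> = 0})"
    using q by (intro finite_UN_I finite_linear_roots poly_roots_finite) auto
  moreover have "finite {b. b * poly p z + ((z - x) * poly r z + poly q z) = 0}"
    using pz F(2) by (intro finite_linear_roots) auto
  ultimately have "finite ((\<Union>\<rho>\<in>{\<rho>. poly p \<rho> = 0}. {b. b * poly q \<rho> + (\<rho> - x) * poly s \<rho> = 0})
      \<union> {b. b * poly p z + ((z - x) * poly r z + poly q z) = 0})"
    by blast
  then show ?thesis
    by (rule rev_finite_subset) (auto simp: M nondegenerate_def algebra_simps)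
qed

lemma adherent_nondegenerate:
  assumes F: "finite F" "set (map snd ps) \<subseteq> F" "z \<in> F" and ps: "ps \<noteq> []"
  shows "lprod ps c \<in> adherent {lprod ps' c | ps'. map snd ps' = map snd ps \<and>
    generic F ps' c \<and> nondegenerate z (lprod ps' c)}" (is "_ \<in> adherent ?S'")
proof -
  let ?S = "{lprod ps' c | ps'. map snd ps' = map snd ps \<and> generic F ps' c}"
  have sub: "?S \<subseteq> adherent ?S'"
  proof
    fix L assume "L \<in> ?S"
    then obtain ps' where L: "L = lprod ps' c"
      and ps': "map snd ps' = map snd ps" "generic F ps' c"
      by blast
    then obtain b x qs where qs: "ps' = (b, x) # qs"
      using ps by (cases ps') auto
    let ?B = "{b. \<not> generic F ((b, x) # qs) c} \<union> {b. \<not> nondegenerate z (lprod ((b, x) # qs) c)}"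
    have snds: "x # map snd qs = map snd ps" using ps'(1) qs by simp
    then have "set (map snd qs) \<subseteq> F"
      using F(2) by (metis list.set_intros(2) subset_code(1))
    then have "finite ?B"
      using ps'(2) qs F by (intro finite_UnI finite_bad_generic finite_bad_nondegenerate) auto
    then have "lprod ps' c \<in> adherent {step b' x (lprod qs c) | b'. b' \<notin> ?B}"
      unfolding qs lprod.simps by (rule adherent_head)
    moreover have "{step b' x (lprod qs c) | b'. b' \<notin> ?B} \<subseteq> ?S'"
    proof
      fix L assume "L \<in> {step b' x (lprod qs c) | b'. b' \<notin> ?B}"
      then obtain b' where "L = step b' x (lprod qs c)" "generic F ((b', x) # qs) c"
          "nondegenerate z (lprod ((b', x) # qs) c)"
        by blast
      then have "L = lprod ((b', x) # qs) c" "generic F ((b', x) # qs) c"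
          "nondegenerate z (lprod ((b', x) # qs) c)" "map snd ((b', x) # qs) = map snd ps"
        using snds by simp_all
      then show "L \<in> ?S'" by blast
    qed
    ultimately show "L \<in> adherent ?S'"
      unfolding L
      by (rule adherent_weaken)
  qed
  show ?thesis
    by (rule subsetD[OF adherent_subset[OF sub] adherent_generic[OF F(1)]])
qed

section \<open>Expansions and quadratic equations\<close>

lemma of_cpoly_add [simp]: "of_cpoly (p + q) = of_cpoly p + of_cpoly q"
  by (simp add: of_cpoly_def flip: to_ac_add)

lemma of_cpoly_mult [simp]: "of_cpoly (p * q) = of_cpoly p * of_cpoly q"
  by (simp add: of_cpoly_def flip: to_ac_mult)

lemma of_cpoly_0 [simp]: "of_cpoly 0 = 0"
  by (simp add: of_cpoly_def flip: Zero_fract_def)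

lemma of_cpoly_1 [simp]: "of_cpoly 1 = 1"
  by (simp add: of_cpoly_def flip: One_fract_def)

lemma of_cpoly_uminus [simp]: "of_cpoly (- p) = - of_cpoly p"
  using of_cpoly_add[of p "- p"] by (simp add: add_eq_0_iff)

lemma of_cpoly_diff [simp]: "of_cpoly (p - q) = of_cpoly p - of_cpoly q"
  using of_cpoly_add[of p "- q"] by simp

lemma of_cpoly_power [simp]: "of_cpoly (p ^ n) = of_cpoly p ^ n"
  by (induction n) auto

lemma of_cpoly_numeral [simp]: "of_cpoly (numeral n) = numeral n"
proof -
  have "of_cpoly (of_nat k) = of_nat k" for k
    by (induction k) auto
  from this[of "numeral n"] show ?thesis by simp
qed

lemma of_cpoly_eq_iff [simp]: "of_cpoly p = of_cpoly q \<longleftrightarrow> p = q"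
  by (simp add: of_cpoly_def eq_fract)

lemma of_cpoly_eq_0_iff [simp]: "of_cpoly p = 0 \<longleftrightarrow> p = 0"
  using of_cpoly_eq_iff[of p 0] by (simp del: of_cpoly_eq_iff)

lemma of_cpoly_smult: "of_cpoly (Polynomial.smult b p) = of_cpoly [:b:] * of_cpoly p"
  by (simp flip: of_cpoly_mult)

text \<open>Homogeneous coordinates on the projective line; junk only at \<open>(0, 0)\<close>.\<close>

definition homog :: "alg_fun \<Rightarrow> alg_fun \<Rightarrow> alg_fun option" where
  "homog u v = (if v = 0 then None else Some (u / v))"

lemma translate_homog: "translate c (homog u v) = homog (c * v + u) v"
  by (simp add: homog_def add_divide_distrib)

lemma divide_into_homog:
  assumes "u \<noteq> 0 \<or> v \<noteq> 0"
  shows "divide_into w (homog u v) = homog (w * v) u"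
  using assms by (simp add: homog_def)

fun apply_mat :: "mat2 \<Rightarrow> alg_fun \<Rightarrow> alg_fun \<times> alg_fun" where
  "apply_mat (p, q, r, s) \<phi> =
     (of_cpoly p * \<phi> + of_cpoly q, of_cpoly r * \<phi> + of_cpoly s)"

fun fixes_point :: "mat2 \<Rightarrow> alg_fun \<Rightarrow> bool" where
  "fixes_point (p, q, r, s) \<phi> \<longleftrightarrow>
     of_cpoly r * \<phi> ^ 2 + (of_cpoly s - of_cpoly p) * \<phi> - of_cpoly q = 0"

text \<open>Joining the translation by b_(k-1) with the map x to (\<lambda> - \<alpha>_k) / x
  applied before it gives the k-th step matrix, which explains why b_i is paired with
  \<alpha>_(i+1). The value at j is the candidate for M_j in the factorisation procedure.\<close>

definition cf_mat :: "nat \<Rightarrow> (nat \<Rightarrow> complex) \<Rightarrow> (nat \<Rightarrow> complex) \<Rightarrow> nat \<Rightarrow> mat2" where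
  "cf_mat N \<alpha> b j = lprod (map (\<lambda>i. (b i, \<alpha> (Suc i))) [j..<N]) (b N - b 0)"

lemma cf_mat_end: "cf_mat N \<alpha> b N = (1, [:b N - b 0:], 0, 1)"
  by (simp add: cf_mat_def)

lemma cf_mat_step:
  "j < N \<Longrightarrow> cf_mat N \<alpha> b j = step (b j) (\<alpha> (Suc j)) (cf_mat N \<alpha> b (Suc j))"
  by (simp add: cf_mat_def upt_conv_Cons)

lemma apply_step:
  "apply_mat (step b x M) \<phi> =
     (of_cpoly [:b:] * fst (apply_mat M \<phi>) + of_cpoly (lin x) * snd (apply_mat M \<phi>),
      fst (apply_mat M \<phi>))"
  by (cases M) (simp add: of_cpoly_smult algebra_simps)

definition tail_value ::
    "nat \<Rightarrow> (nat \<Rightarrow> complex) \<Rightarrow> (nat \<Rightarrow> complex) \<Rightarrow> alg_fun \<Rightarrow> nat \<Rightarrow> alg_fun option" where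
  "tail_value N \<alpha> b \<phi> k = foldr (\<circ>) (map (s_map N \<alpha> b) [k..<Suc N]) id (Some \<phi>)"

lemma tail_value_end: "tail_value N \<alpha> b \<phi> (Suc N) = Some \<phi>"
  by (simp add: tail_value_def)

lemma tail_value_step:
  "k \<le> N \<Longrightarrow> tail_value N \<alpha> b \<phi> k = s_map N \<alpha> b k (tail_value N \<alpha> b \<phi> (Suc k))"
  by (simp add: tail_value_def upt_conv_Cons del: upt_Suc)

lemma s_map_Suc:
  assumes "j < N"
  shows "s_map N \<alpha> b (Suc j) x = divide_into (of_cpoly (lin (\<alpha> (Suc j))))
    (translate (of_cpoly [:if Suc j = N then b N - b 0 else b (Suc j):]) x)"
  using assms by (cases "Suc j = N") (auto simp: s_map_def)

text \<open>Downward induction with the nonzero vector carried along: (b * u + (\<lambda> -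
  \<alpha>) * v, u) = (0, 0) would force u = v = 0. So maps and matrices agree even where a value is
  infinite.\<close>

lemma translate_tail_value:
  assumes "j \<le> N"
  shows "apply_mat (cf_mat N \<alpha> b j) \<phi> \<noteq> (0, 0) \<and>
    translate (of_cpoly [:if j = N then b N - b 0 else b j:]) (tail_value N \<alpha> b \<phi> (Suc j)) =
    homog (fst (apply_mat (cf_mat N \<alpha> b j) \<phi>)) (snd (apply_mat (cf_mat N \<alpha> b j) \<phi>))"
  using assms
proof (induction j rule: inc_induct)
  case base
  then show ?case by (simp add: cf_mat_end homog_def tail_value_end algebra_simps)
next
  case (step j)
  obtain u v where uv: "apply_mat (cf_mat N \<alpha> b (Suc j)) \<phi> = (u, v)"
    by fastforce
  have ne: "u \<noteq> 0 \<or> v \<noteq> 0"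
    using step.IH uv by auto
  have IH: "translate (of_cpoly [:if Suc j = N then b N - b 0 else b (Suc j):])
      (tail_value N \<alpha> b \<phi> (Suc (Suc j))) = homog u v"
    using step.IH uv by simp
  have "tail_value N \<alpha> b \<phi> (Suc j) = divide_into (of_cpoly (lin (\<alpha> (Suc j)))) (homog u v)"
    using step.hyps unfolding IH[symmetric] by (simp only: tail_value_step s_map_Suc Suc_le_eq)
  also have "\<dots> = homog (of_cpoly (lin (\<alpha> (Suc j))) * v) u"
    by (rule divide_into_homog[OF ne])
  finally show ?case
    using step.hyps ne by (auto simp: cf_mat_step apply_step uv translate_homog)
qed

lemma has_expansion_iff:
  assumes "N > 0"
  shows "has_expansion N \<alpha> b \<phi> \<longleftrightarrow> periodic_coeffs N b \<and> fixes_point (cf_mat N \<alpha> b 0) \<phi>"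
proof -
  obtain p q r s where M: "cf_mat N \<alpha> b 0 = (p, q, r, s)" using prod_cases4 by blast
  define u v where "u = of_cpoly p * \<phi> + of_cpoly q" and "v = of_cpoly r * \<phi> + of_cpoly s"
  have "s_comp N \<alpha> b (Some \<phi>) = tail_value N \<alpha> b \<phi> 0"
    by (simp add: s_comp_def tail_value_def)
  also have "\<dots> = translate (of_cpoly [:b 0:]) (tail_value N \<alpha> b \<phi> (Suc 0))"
    by (simp add: tail_value_step s_map_def)
  also have "\<dots> = homog u v"
    using translate_tail_value[of 0 N \<alpha> b \<phi>] assms by (simp add: M u_def v_def)
  finally have eq: "s_comp N \<alpha> b (Some \<phi>) = homog u v" .
  have ne: "u \<noteq> 0 \<or> v \<noteq> 0"
    using translate_tail_value[of 0 N \<alpha> b \<phi>] by (simp add: M u_def v_def)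
  \<comment> \<open>If v = 0 then u \<noteq> 0 and both sides are false.\<close>
  have "homog u v = Some \<phi> \<longleftrightarrow> u = \<phi> * v"
    using ne by (auto simp: homog_def)
  also have "\<dots> \<longleftrightarrow> fixes_point (p, q, r, s) \<phi>"
    by (auto simp: u_def v_def algebra_simps power2_eq_square)
  finally show ?thesis
    by (simp add: has_expansion_def eq M)
qed

section \<open>The factorisation procedure in terms of continued fraction products\<close>

fun to_mat :: "mat2 \<Rightarrow> complex poly ^ 2 ^ 2" where
  "to_mat (p, q, r, s) = vector [vector [p, q], vector [r, s]]"

fun start_tuple :: "triple \<Rightarrow> complex poly \<Rightarrow> mat2" where
  "start_tuple (A, B, C) T = (T - B, - C, A, T + B)"

lemma start_matrix_eq: "start_matrix t T = to_mat (start_tuple t T)"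
  by (cases t) simp

lemma to_mat_inject: "to_mat L = to_mat M \<longleftrightarrow> L = M"
  by (cases L; cases M) (auto simp: vec_eq_iff forall_2)

lemma step_matrix_mult: "step_matrix b x ** to_mat M = to_mat (step b x M)"
  by (cases M) (simp add: step_matrix_def vec_eq_iff forall_2 matrix_matrix_mult_def sum_2)

text \<open>At x the term with \<lambda> - x drops out, so the first row is b times the second; this
  is how the null vector reads off the coefficient.\<close>

lemma null_vector_step:
  "transpose (map_matrix (\<lambda>p. poly p x) (to_mat (step b x M))) *v vector [1, - b] = 0"
  by (cases M)
    (simp add: vec_eq_iff forall_2 matrix_vector_mult_def sum_2 transpose_def map_matrix_def)

text \<open>The equations L_k M_k = M_(k-1) and the prescribed form of M_N determine every M_k from
  the end backwards, namely as \<open>cf_mat\<close>.\<close>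

lemma procedure_output_iff:
  "procedure_output N \<alpha> t T b \<longleftrightarrow>
     periodic_coeffs N b \<and> cf_mat N \<alpha> b 0 = start_tuple t T" (is "?L \<longleftrightarrow> ?R")
proof
  assume L: ?L
  then have "periodic_coeffs N b" by (simp add: procedure_output_def)
  from L obtain M where M: "M 0 = start_matrix t T"
    "\<forall>k\<in>{1..N}. transpose (map_matrix (\<lambda>p. poly p (\<alpha> k)) (M (k - 1))) *v vector [1, - b (k - 1)] = 0 \<and>
       step_matrix (b (k - 1)) (\<alpha> k) ** M k = M (k - 1)"
    "M N = vector [vector [1, [:b N - b 0:]], vector [0, 1]]"
    unfolding procedure_output_def by (elim conjE exE) (rule that)
  have "M j = to_mat (cf_mat N \<alpha> b j)" if "j \<le> N" for j
    using that
  proof (induction j rule: inc_induct)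
    case base
    then show ?case by (simp add: M(3) cf_mat_end)
  next
    case (step j)
    then show ?case
      using bspec[OF M(2), of "Suc j"] by (simp add: cf_mat_step step_matrix_mult)
  qed
  from this[of 0] show ?R
    using M(1) \<open>periodic_coeffs N b\<close> by (simp add: start_matrix_eq to_mat_inject)
next
  assume R: ?R
  define M where "M k = to_mat (cf_mat N \<alpha> b k)" for k
  have steps: "transpose (map_matrix (\<lambda>p. poly p (\<alpha> k)) (M (k - 1))) *v vector [1, - b (k - 1)] = 0 \<and>
      step_matrix (b (k - 1)) (\<alpha> k) ** M k = M (k - 1)" if "k \<in> {1..N}" for k
  proof -
    obtain j where j: "k = Suc j" "j < N" using \<open>k \<in> {1..N}\<close> by (cases k) auto
    have M: "M (k - 1) = to_mat (step (b j) (\<alpha> k) (cf_mat N \<alpha> b k))"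
      by (simp add: M_def j cf_mat_step)
    show ?thesis
      unfolding M unfolding M_def j(1) diff_Suc_1 step_matrix_mult
      by (rule conjI[OF null_vector_step refl])
  qed
  have ends: "M 0 = start_matrix t T" "M N = vector [vector [1, [:b N - b 0:]], vector [0, 1]]"
    using R by (simp_all add: M_def start_matrix_eq cf_mat_end)
  show ?L
    unfolding procedure_output_def
    by (rule conjI[OF conjunct1[OF R]], rule exI[of _ M], rule conjI[OF ends(1)],
        rule conjI[OF _ ends(2)], rule ballI, rule steps)
qed

section \<open>Shaped matrices as triples with a chosen root T\<close>

definition points :: "nat \<Rightarrow> (nat \<Rightarrow> complex) \<Rightarrow> complex list" where
  "points N \<alpha> = map (\<lambda>i. \<alpha> (Suc i)) [0..<N]"

lemma length_points [simp]: "length (points N \<alpha>) = N"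
  by (simp add: points_def)

lemma set_points: "set (points N \<alpha>) = \<alpha> ` {1..N}"
proof -
  have "{1..N} = Suc ` {0..<N}"
    using image_Suc_atLeastLessThan[of 0 N] by auto
  then show ?thesis unfolding points_def by (simp only: image_image set_map set_upt)
qed

lemma distinct_points: "alpha_seq N \<alpha> \<Longrightarrow> distinct (points N \<alpha>)"
  unfolding points_def alpha_seq_def
  by (auto simp: distinct_map intro!: inj_onI dest: inj_onD)

lemma prod_points:
  assumes "odd N"
  shows "(\<Prod>x\<leftarrow>points N \<alpha>. - lin x) = - alpha_poly N \<alpha>"
proof -
  have "(\<Prod>x\<leftarrow>points n \<alpha>. - lin x) = (- 1) ^ n * alpha_poly n \<alpha>" for n
    by (induction n) (simp_all add: points_def alpha_poly_def)
  then show ?thesis using assms by simp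
qed

lemma cf_mat_in_shaped: "cf_mat N \<alpha> b 0 \<in> shaped (points N \<alpha>)"
  using lprod_in_shaped[of "map (\<lambda>i. (b i, \<alpha> (Suc i))) [0..<N]" "b N - b 0"]
  by (simp add: cf_mat_def points_def comp_def)

fun triple_of :: "mat2 \<Rightarrow> triple" where
  "triple_of (p, q, r, s) = (r, Polynomial.smult (1 / 2) (s - p), - q)"

fun half_trace :: "mat2 \<Rightarrow> complex poly" where
  "half_trace (p, q, r, s) = Polynomial.smult (1 / 2) (p + s)"

lemma start_tuple_triple_of: "start_tuple (triple_of M) (half_trace M) = M"
  by (cases M) (auto simp: poly_eq_iff field_simps)

lemma triple_of_start_tuple [simp]: "triple_of (start_tuple t T) = t"
  by (cases t) (simp add: poly_eq_iff numeral_poly)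

lemma half_trace_start_tuple [simp]: "half_trace (start_tuple t T) = T"
  by (cases t) (simp add: poly_eq_iff numeral_poly)

lemma start_tuple_inject: "start_tuple t T = start_tuple t' T' \<longleftrightarrow> t = t' \<and> T = T'"
proof
  assume eq: "start_tuple t T = start_tuple t' T'"
  show "t = t' \<and> T = T'"
    using arg_cong[OF eq, of triple_of] arg_cong[OF eq, of half_trace] by simp
qed simp

lemma det_start_tuple: "det2 (start_tuple t T) = T ^ 2 - discr t"
  by (cases t) (simp add: power2_eq_square algebra_simps)

text \<open>Row index N + 1 = 2 * (g + 1) makes - C monic of degree g + 1, row index N = 2 * g + 1
  makes A monic of degree g, and the determinant, the negative of
  \<open>alpha_poly N \<alpha>\<close> as N is odd, expresses admissibility with S = T.\<close>

lemma start_tuple_in_shaped_iff: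
  assumes "N = 2 * g + 1"
  shows "start_tuple t T \<in> shaped (points N \<alpha>) \<longleftrightarrow> t \<in> triples g N \<alpha> \<and> procedure_root g N \<alpha> t T"
proof -
  obtain A B C where t: "t = (A, B, C)" by (cases t)
  have odd: "odd N" using assms by simp
  have det: "det2 (start_tuple t T) = (\<Prod>x\<leftarrow>points N \<alpha>. - lin x) \<longleftrightarrow>
      T ^ 2 = discr t - alpha_poly N \<alpha>"
    unfolding det_start_tuple prod_points[OF odd] by (auto simp: algebra_simps)
  have degs: "Polynomial.degree p \<le> n \<longleftrightarrow> (\<forall>i>n. poly.coeff p i = 0)" for p :: "complex poly" and n
    by (auto intro: degree_le coeff_eq_0)
  have monic: "Polynomial.degree p = n \<and> Polynomial.lead_coeff p = c \<longleftrightarrow>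
      (\<forall>i>n. poly.coeff p i = 0) \<and> poly.coeff p n = c" if "c \<noteq> 0" for p :: "complex poly" and n c
  proof
    assume *: "(\<forall>i>n. poly.coeff p i = 0) \<and> poly.coeff p n = c"
    then have "Polynomial.degree p \<le> n" "n \<le> Polynomial.degree p"
      using that by (auto intro: degree_le le_degree)
    then show "Polynomial.degree p = n \<and> Polynomial.lead_coeff p = c"
      using * by simp
  qed (auto intro: coeff_eq_0)
  have "poly.coeff (T - B) i = 0 \<and> poly.coeff (T + B) i = 0 \<longleftrightarrow>
      poly.coeff B i = 0 \<and> poly.coeff T i = 0" for i
  proof -
    have "t - b = 0 \<and> t + b = 0 \<longleftrightarrow> b = 0 \<and> t = 0" for b t :: complex
      by auto
    then show ?thesis by simp
  qed
  then have B: "(\<forall>i>g. poly.coeff (T - B) i = 0) \<and> (\<forall>i>g. poly.coeff (T + B) i = 0) \<longleftrightarrow>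
      Polynomial.degree B \<le> g \<and> Polynomial.degree T \<le> g"
    unfolding degs by blast
  have shape: "row_shape (Suc N) (T - B) (- C) \<and> row_shape N A (T + B) \<longleftrightarrow>
      Polynomial.degree A = g \<and> Polynomial.lead_coeff A = 1 \<and> Polynomial.degree C = g + 1 \<and>
      Polynomial.lead_coeff C = - 1 \<and> Polynomial.degree B \<le> g \<and> Polynomial.degree T \<le> g"
  proof -
    have N_div: "Suc N div 2 = Suc g" "N div 2 = g" using assms by auto
    have "row_shape (Suc N) (T - B) (- C) \<and> row_shape N A (T + B) \<longleftrightarrow>
        ((\<forall>i>g. poly.coeff A i = 0) \<and> poly.coeff A g = 1) \<and>
        ((\<forall>i>g + 1. poly.coeff C i = 0) \<and> poly.coeff C (g + 1) = - 1) \<and>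
        ((\<forall>i>g. poly.coeff (T - B) i = 0) \<and> (\<forall>i>g. poly.coeff (T + B) i = 0))"
      using odd unfolding row_shape_def N_div Suc_le_eq
      by (simp add: minus_equation_iff[of _ 1] equation_minus_iff del: coeff_diff coeff_add) blast
    also have "\<dots> \<longleftrightarrow> ((Polynomial.degree A = g \<and> Polynomial.lead_coeff A = 1) \<and>
        (Polynomial.degree C = g + 1 \<and> Polynomial.lead_coeff C = - 1) \<and>
        (Polynomial.degree B \<le> g \<and> Polynomial.degree T \<le> g))"
      unfolding B by (subst (1 2) monic) simp_all
    finally show ?thesis by (simp only: conj_assoc)
  qed
  have adm: "alpha_admissible g N \<alpha> (discr t)" if "T ^ 2 = discr t - alpha_poly N \<alpha>" "Polynomial.degree T \<le> g"
    unfolding alpha_admissible_def using that by (intro exI[of _ T]) simp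
  have "start_tuple t T \<in> shaped (points N \<alpha>) \<longleftrightarrow>
      (row_shape (Suc N) (T - B) (- C) \<and> row_shape N A (T + B)) \<and> T ^ 2 = discr t - alpha_poly N \<alpha>"
    using det by (simp add: shaped_def t)
  also have "\<dots> \<longleftrightarrow> t \<in> triples g N \<alpha> \<and> procedure_root g N \<alpha> t T"
    unfolding shape using adm by (auto simp: triples_def procedure_root_def t)
  finally show ?thesis .
qed

lemma shaped_start_tuple:
  assumes "N = 2 * g + 1" "M \<in> shaped (points N \<alpha>)"
  obtains t T where "M = start_tuple t T" "t \<in> triples g N \<alpha>" "procedure_root g N \<alpha> t T"
  using start_tuple_in_shaped_iff[OF assms(1)] assms(2) start_tuple_triple_of by metis

section \<open>The quadratic equation of an expansion and its uniqueness\<close>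

lemma eq_divide_iff_affine:
  fixes a b r \<phi> :: "'a :: field"
  assumes "a \<noteq> 0"
  shows "\<phi> = (- b + r) / a \<longleftrightarrow> a * \<phi> + b = r"
  using assms by (auto simp: field_simps)

text \<open>Completing the square: the square of A * \<phi> + B is R plus A times the quadratic. The
  required root of R is A * \<phi> + B itself, so no branch has to be chosen.\<close>

lemma represents_iff:
  assumes "A \<noteq> 0"
  shows "represents (A, B, C) \<phi> \<longleftrightarrow>
    of_cpoly A * \<phi> ^ 2 + 2 * of_cpoly B * \<phi> + of_cpoly C = 0" (is "?L \<longleftrightarrow> ?Q = 0")
proof -
  have A: "of_cpoly A \<noteq> 0" using assms by simp
  have id: "(of_cpoly A * \<phi> + of_cpoly B)\<^sup>2 = of_cpoly (discr (A, B, C)) + of_cpoly A * ?Q"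
    by (simp add: power2_eq_square algebra_simps)
  have "?L \<longleftrightarrow> (\<exists>r. r\<^sup>2 = of_cpoly (discr (A, B, C)) \<and> of_cpoly A * \<phi> + of_cpoly B = r)"
    unfolding represents.simps eq_divide_iff_affine[OF A] ..
  also have "\<dots> \<longleftrightarrow> (of_cpoly A * \<phi> + of_cpoly B)\<^sup>2 = of_cpoly (discr (A, B, C))"
    by blast
  also have "\<dots> \<longleftrightarrow> ?Q = 0"
    unfolding id using A by (simp only: add_cancel_left_right mult_eq_0_iff simp_thms)
  finally show ?thesis .
qed

text \<open>T cancels from s - p = 2 * B, so the fixed points depend on the triple only. This is why
  T and - T lead to expansions of the same \<phi>.\<close>

lemma fixes_start_tuple_iff:
  assumes "t \<in> triples g N \<alpha>"
  shows "fixes_point (start_tuple t T) \<phi> \<longleftrightarrow> represents t \<phi>"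
proof -
  obtain A B C where t: "t = (A, B, C)" by (cases t)
  have "A \<noteq> 0" using assms by (auto simp: triples_def t)
  then show ?thesis
    unfolding t represents_iff[OF \<open>A \<noteq> 0\<close>] by (simp add: algebra_simps)
qed

lemma degree_discr:
  assumes "N = 2 * g + 1" "t \<in> triples g N \<alpha>"
  shows "Polynomial.degree (discr t) = N" "discr t \<noteq> 0"
proof -
  obtain S where S: "Polynomial.degree S \<le> g" "discr t = S ^ 2 + alpha_poly N \<alpha>"
    using assms(2) by (auto simp: triples_def alpha_admissible_def)
  have "Polynomial.degree (alpha_poly N \<alpha>) = N"
    unfolding alpha_poly_def by (subst degree_prod_eq_sum_degree) auto
  moreover have "Polynomial.degree (S ^ 2) < N"
    using degree_power_le[of S 2] S(1) assms(1) by linarith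
  ultimately show "Polynomial.degree (discr t) = N"
    using S(2) by (simp add: degree_add_eq_right)
  then show "discr t \<noteq> 0" using assms(1) by auto
qed

text \<open>
  The discriminant has odd degree, so \<open>\<phi>\<close> is irrational and its quadratic equation is unique up to
  a factor.
\<close>

lemma quadratics_proportional:
  assumes N: "N = 2 * g + 1" and t: "(A, B, C) \<in> triples g N \<alpha>" "represents (A, B, C) \<phi>"
    and t': "(A', B', C') \<in> triples g N \<alpha>" "represents (A', B', C') \<phi>"
  shows "A' * B = A * B'" "A' * C = A * C'" "B' * C = B * C'"
proof -
  have A: "A \<noteq> 0" "A' \<noteq> 0" using t t' by (auto simp: triples_def)
  have q: "of_cpoly A * \<phi> ^ 2 + 2 * of_cpoly B * \<phi> + of_cpoly C = 0"
      "of_cpoly A' * \<phi> ^ 2 + 2 * of_cpoly B' * \<phi> + of_cpoly C' = 0"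
    using t(2) t'(2) represents_iff A by blast+
  define E where "E = A * B' - A' * B"
  define F where "F = A' * C - A * C'"
  \<comment> \<open>Eliminating \<phi>^2 leaves a linear equation for \<phi>. If its coefficient E
    were nonzero, inserting it into the completed square would make (2 * E)^2 * R the square of a
    polynomial, although its degree is odd.\<close>
  have "of_cpoly A * (of_cpoly A' * \<phi> ^ 2 + 2 * of_cpoly B' * \<phi> + of_cpoly C')
      - of_cpoly A' * (of_cpoly A * \<phi> ^ 2 + 2 * of_cpoly B * \<phi> + of_cpoly C) = 0"
    unfolding q by simp
  then have lin_eq: "2 * of_cpoly E * \<phi> = of_cpoly F"
    by (simp add: E_def F_def algebra_simps)
  have "E = 0"
  proof (rule ccontr)
    assume E: "E \<noteq> 0"
    have "(2 * of_cpoly E * (of_cpoly A * \<phi> + of_cpoly B))\<^sup>2 =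
        (of_cpoly A * (2 * of_cpoly E * \<phi>) + 2 * of_cpoly E * of_cpoly B)\<^sup>2"
      by (simp add: algebra_simps)
    also have "\<dots> = of_cpoly ((A * F + 2 * E * B) ^ 2)"
      unfolding lin_eq by simp
    also have "(2 * of_cpoly E * (of_cpoly A * \<phi> + of_cpoly B))\<^sup>2 =
        (2 * of_cpoly E)\<^sup>2 * (of_cpoly (discr (A, B, C)) +
          of_cpoly A * (of_cpoly A * \<phi> ^ 2 + 2 * of_cpoly B * \<phi> + of_cpoly C))"
      by (simp add: power2_eq_square algebra_simps)
    also have "\<dots> = of_cpoly ((2 * E) ^ 2 * discr (A, B, C))"
      unfolding q by simp
    finally have eq: "(2 * E) ^ 2 * discr (A, B, C) = (A * F + 2 * E * B) ^ 2"
      unfolding of_cpoly_eq_iff .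
    have "Polynomial.degree ((2 * E) ^ 2 * discr (A, B, C)) = 2 * Polynomial.degree (2 * E) + N"
      using degree_discr[OF N t(1)] E by (simp add: degree_mult_eq degree_power_eq)
    moreover have "even (Polynomial.degree ((A * F + 2 * E * B) ^ 2))"
      by (cases "A * F + 2 * E * B = 0") (simp_all add: degree_power_eq)
    ultimately show False
      unfolding eq using N by simp
  qed
  then have "F = 0" using lin_eq by simp
  show AB: "A' * B = A * B'" and AC: "A' * C = A * C'"
    using \<open>E = 0\<close> \<open>F = 0\<close> by (simp_all add: E_def F_def)
  have "A * (B' * C) = A' * B * C" by (simp add: AB)
  also have "\<dots> = A * (B * C')" using AC by (simp add: algebra_simps)
  finally show "B' * C = B * C'" using A(1) by simp
qed

lemma complex_poly_coprime:
  fixes p q :: "complex poly"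
  assumes "\<And>z. poly p z = 0 \<Longrightarrow> poly q z \<noteq> 0" "p \<noteq> 0"
  shows "coprime p q"
proof (rule coprimeI)
  fix d assume d: "d dvd p" "d dvd q"
  then have "d \<noteq> 0" using assms(2) by auto
  have "poly d z \<noteq> 0" for z
    using d assms(1) by (metis dvd_trans poly_eq_0_iff_dvd)
  then have "Polynomial.degree d = 0"
    using fundamental_theorem_of_algebra[of d] constant_degree[of d] by blast
  then show "is_unit d" using \<open>d \<noteq> 0\<close> by (simp add: is_unit_iff_degree)
qed

text \<open>A divides A' * C and is coprime to C, hence divides A'. Both are monic of degree g, so
  they agree, and proportionality gives the other two entries.\<close>

lemma triple_unique:
  assumes N: "N = 2 * g + 1" and t: "(A, B, C) \<in> triples g N \<alpha>" "represents (A, B, C) \<phi>"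
    and t': "(A', B', C') \<in> triples g N \<alpha>" "represents (A', B', C') \<phi>"
    and cop: "\<And>z. poly A z = 0 \<Longrightarrow> poly C z \<noteq> 0"
  shows "(A', B', C') = (A, B, C)"
proof -
  note eqs = quadratics_proportional[OF N t t']
  have A: "A \<noteq> 0" "Polynomial.degree A = g" "Polynomial.lead_coeff A = 1"
    and A': "A' \<noteq> 0" "Polynomial.degree A' = g" "Polynomial.lead_coeff A' = 1"
    using t t' by (auto simp: triples_def)
  have "A dvd A' * C" unfolding eqs(2) by simp
  then have "A dvd A'"
    using complex_poly_coprime[OF cop A(1)] by (simp add: coprime_dvd_mult_left_iff)
  then obtain k where k: "A' = A * k" by (elim dvdE)
  then have "k \<noteq> 0" "Polynomial.degree k = 0"
    using A' A by (auto simp: degree_mult_eq)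
  then obtain c where "k = [:c:]" using degree_eq_zeroE by blast
  then have "A' = A" using A A' k by (simp add: lead_coeff_mult)
  then show ?thesis using eqs(1,2) A(1) by simp
qed

section \<open>Rational formulas for the coefficients\<close>

fun column_at :: "bool \<Rightarrow> mat2 \<Rightarrow> complex \<Rightarrow> complex \<times> complex" where
  "column_at c (p, q, r, s) z = (if c then (poly p z, poly r z) else (poly q z, poly s z))"

lemma column_at_step:
  "column_at c (step b a M) z =
     (b * fst (column_at c M z) + (z - a) * snd (column_at c M z), fst (column_at c M z))"
  by (cases M) (simp add: algebra_simps)

definition eval_coords :: "nat \<Rightarrow> (coord \<Rightarrow> complex) \<Rightarrow> (nat \<Rightarrow> coord) \<Rightarrow> nat \<Rightarrow> complex" where
  "eval_coords n x V j = (\<Sum>m\<le>n. x (V m) * x (Coord_alpha j) ^ m)"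

text \<open>
  \<open>scaled_column n x c k j\<close> is a column of \<open>M\<^sub>k\<close>, evaluated at \<open>\<alpha>\<^sub>j\<close> and multiplied by the product of
  the denominators that occurred before: this keeps everything polynomial in the coordinates \<open>x\<close>.
  The first column (\<open>c = True\<close>) provides numerator and denominator of each \<open>b\<^sub>k\<close>.
\<close>

fun scaled_column ::
    "nat \<Rightarrow> (coord \<Rightarrow> complex) \<Rightarrow> bool \<Rightarrow> nat \<Rightarrow> nat \<Rightarrow> complex \<times> complex" where
  "scaled_column n x c 0 j =
     (if c then (eval_coords n x Coord_T j - eval_coords n x Coord_B j, eval_coords n x Coord_A j)
      else (- eval_coords n x Coord_C j, eval_coords n x Coord_T j + eval_coords n x Coord_B j))"
| "scaled_column n x c (Suc k) j =
     (snd (scaled_column n x True k (Suc k)) * (x (Coord_alpha j) - x (Coord_alpha (Suc k))) *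
        snd (scaled_column n x c k j),
      snd (scaled_column n x True k (Suc k)) * fst (scaled_column n x c k j) -
        fst (scaled_column n x True k (Suc k)) * snd (scaled_column n x c k j))"

definition numer :: "nat \<Rightarrow> nat \<Rightarrow> (coord \<Rightarrow> complex) \<Rightarrow> complex" where
  "numer n k x = fst (scaled_column n x True k (Suc k))"

definition denom :: "nat \<Rightarrow> nat \<Rightarrow> (coord \<Rightarrow> complex) \<Rightarrow> complex" where
  "denom n k x = snd (scaled_column n x True k (Suc k))"

lemma polynomial_fun_uminus: "polynomial_fun p \<Longrightarrow> polynomial_fun (\<lambda>x. - p x)"
  using polynomial_fun.mult[OF polynomial_fun.const[of "- 1"]] by simp

lemma polynomial_fun_diff:
  "polynomial_fun p \<Longrightarrow> polynomial_fun q \<Longrightarrow> polynomial_fun (\<lambda>x. p x - q x)"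
  using polynomial_fun.add[OF _ polynomial_fun_uminus] by simp

lemma polynomial_fun_power: "polynomial_fun p \<Longrightarrow> polynomial_fun (\<lambda>x. p x ^ n)"
  by (induction n) (auto intro: polynomial_fun.intros)

lemma polynomial_fun_sum:
  "(\<And>i. i \<in> I \<Longrightarrow> polynomial_fun (f i)) \<Longrightarrow> polynomial_fun (\<lambda>x. \<Sum>i\<in>I. f i x)"
  by (induction I rule: infinite_finite_induct) (auto intro: polynomial_fun.intros)

lemmas polynomial_fun_intros =
  polynomial_fun.intros polynomial_fun_uminus polynomial_fun_diff polynomial_fun_power
  polynomial_fun_sum

lemma polynomial_fun_eval_coords: "polynomial_fun (\<lambda>x. eval_coords n x V j)"
  unfolding eval_coords_def by (intro polynomial_fun_intros)

lemma polynomial_fun_scaled_column: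
  "polynomial_fun (\<lambda>x. fst (scaled_column n x c k j)) \<and>
   polynomial_fun (\<lambda>x. snd (scaled_column n x c k j))"
proof (induction k arbitrary: c j)
  case 0
  show ?case
    by (cases c) (auto intro: polynomial_fun_intros polynomial_fun_eval_coords)
next
  case (Suc k)
  show ?case
    unfolding scaled_column.simps fst_conv snd_conv
    by (intro conjI polynomial_fun_intros conjunct1[OF Suc] conjunct2[OF Suc])
qed

lemma polynomial_fun_numer: "polynomial_fun (numer n k)"
  and polynomial_fun_denom: "polynomial_fun (denom n k)"
  using polynomial_fun_scaled_column unfolding numer_def denom_def by auto

lemma poly_eq_sum_le:
  fixes p :: "complex poly"
  assumes "Polynomial.degree p \<le> n"
  shows "poly p z = (\<Sum>m\<le>n. poly.coeff p m * z ^ m)"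
  unfolding poly_altdef using assms by (intro sum.mono_neutral_left) (auto simp: coeff_eq_0)

text \<open>Inverting the i-th step matrix at \<alpha>_j divides by \<alpha>_j - \<alpha>_(i+1), and
  b_i brings in a denominator: these are the factors that \<open>scaled_column\<close> accumulates.
  The product vanishes for 1 \<le> j \<le> k, but stage k is used at later indices, where
  distinctness of the parameters helps.\<close>

definition scale_factor :: "nat \<Rightarrow> (nat \<Rightarrow> complex) \<Rightarrow> (coord \<Rightarrow> complex) \<Rightarrow> nat \<Rightarrow> nat \<Rightarrow> complex" where
  "scale_factor n \<alpha> x k j = (\<Prod>i<k. denom n i x * (\<alpha> j - \<alpha> (Suc i)))"

definition degrees_le :: "nat \<Rightarrow> triple \<Rightarrow> complex poly \<Rightarrow> bool" where
  "degrees_le n = (\<lambda>(A, B, C) T. Polynomial.degree A \<le> n \<and> Polynomial.degree B \<le> n \<and>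
     Polynomial.degree C \<le> n \<and> Polynomial.degree T \<le> n)"

lemma coord_values_alpha [simp]: "coord_values \<alpha> t T (Coord_alpha j) = \<alpha> j"
  by (cases t) simp

text \<open>A partial factorisation up to stage m is enough here, so the identity serves both to
  compute the coefficients of a given expansion and to construct one stage by stage.\<close>

lemma scaled_column_eq:
  assumes deg: "degrees_le n t T" and M0: "M 0 = start_tuple t T"
    and M: "\<And>k. k < m \<Longrightarrow> M k = step (b k) (\<alpha> (Suc k)) (M (Suc k))"
    and "k \<le> m"
  shows "scaled_column n (coord_values \<alpha> t T) c k j =
    (scale_factor n \<alpha> (coord_values \<alpha> t T) k j * fst (column_at c (M k) (\<alpha> j)),
     scale_factor n \<alpha> (coord_values \<alpha> t T) k j * snd (column_at c (M k) (\<alpha> j)))"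
  using \<open>k \<le> m\<close>
proof (induction k arbitrary: c j)
  case 0
  obtain A B C where t: "t = (A, B, C)" by (cases t)
  show ?case
    using deg by (simp add: M0 t scale_factor_def eval_coords_def degrees_le_def flip: poly_eq_sum_le)
next
  case (Suc k)
  let ?x = "coord_values \<alpha> t T"
  define S where "S = scale_factor n \<alpha> ?x k"
  obtain u v where uv: "column_at c (M (Suc k)) (\<alpha> j) = (u, v)" by fastforce
  obtain u' v' where uv': "column_at True (M (Suc k)) (\<alpha> (Suc k)) = (u', v')" by fastforce
  have IH: "scaled_column n ?x c k j = (S j * (b k * u + (\<alpha> j - \<alpha> (Suc k)) * v), S j * u)"
    using Suc.IH[of c j] Suc.prems M[of k] by (simp add: S_def column_at_step uv)
  have IH': "scaled_column n ?x True k (Suc k) = (S (Suc k) * (b k * u'), S (Suc k) * u')"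
    using Suc.IH[of True "Suc k"] Suc.prems M[of k] by (simp add: S_def column_at_step uv')
  have sc: "scale_factor n \<alpha> ?x (Suc k) j = S j * (S (Suc k) * u' * (\<alpha> j - \<alpha> (Suc k)))"
    by (simp add: scale_factor_def S_def denom_def IH'[unfolded S_def scale_factor_def])
  show ?case
    unfolding scaled_column.simps IH IH' uv sc by (simp add: algebra_simps)
qed

lemma scale_factor_neq_0:
  assumes "alpha_seq N \<alpha>" "k < N" "\<And>i. i < k \<Longrightarrow> denom n i x \<noteq> 0"
  shows "scale_factor n \<alpha> x k (Suc k) \<noteq> 0"
proof -
  have "\<alpha> (Suc k) \<noteq> \<alpha> (Suc i)" if "i < k" for i
    using assms(1,2) that inj_onD[of \<alpha> "{1..N}" "Suc k" "Suc i"] by (auto simp: alpha_seq_def)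
  then show ?thesis
    using assms(3) by (auto simp: scale_factor_def)
qed

definition regular :: "nat \<Rightarrow> nat \<Rightarrow> (nat \<Rightarrow> complex) \<Rightarrow> triple \<Rightarrow> complex poly \<Rightarrow> bool" where
  "regular g N \<alpha> t T \<longleftrightarrow> (\<forall>k<N. denom (g + 1) k (coord_values \<alpha> t T) \<noteq> 0)"

lemma degrees_le_triples:
  assumes "t \<in> triples g N \<alpha>" "procedure_root g N \<alpha> t T"
  shows "degrees_le (g + 1) t T"
  using assms by (cases t) (auto simp: degrees_le_def triples_def procedure_root_def)

lemma cf_mat_scaled_column:
  assumes "t \<in> triples g N \<alpha>" "procedure_root g N \<alpha> t T" "cf_mat N \<alpha> b 0 = start_tuple t T" "k \<le> N"
  shows "scaled_column (g + 1) (coord_values \<alpha> t T) c k j =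
    (scale_factor (g + 1) \<alpha> (coord_values \<alpha> t T) k j * fst (column_at c (cf_mat N \<alpha> b k) (\<alpha> j)),
     scale_factor (g + 1) \<alpha> (coord_values \<alpha> t T) k j * snd (column_at c (cf_mat N \<alpha> b k) (\<alpha> j)))"
  using degrees_le_triples[OF assms(1,2)] assms(3,4)
  by (intro scaled_column_eq[where m = N and b = b and M = "cf_mat N \<alpha> b"] cf_mat_step) auto

text \<open>Each denominator is the true lower left entry at \<alpha>_(k+1) times a scale factor
  built from earlier denominators and differences of parameters; strong induction on k
  applies.\<close>

lemma regularI:
  assumes \<alpha>: "alpha_seq N \<alpha>" and t: "t \<in> triples g N \<alpha>" "procedure_root g N \<alpha> t T"
    and M: "cf_mat N \<alpha> b 0 = start_tuple t T"
    and nz: "\<And>k. k < N \<Longrightarrow> snd (column_at True (cf_mat N \<alpha> b k) (\<alpha> (Suc k))) \<noteq> 0"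
  shows "regular g N \<alpha> t T"
proof -
  have "denom (g + 1) k (coord_values \<alpha> t T) \<noteq> 0" if "k < N" for k
    using that
  proof (induction k rule: less_induct)
    case (less k)
    then have "scale_factor (g + 1) \<alpha> (coord_values \<alpha> t T) k (Suc k) \<noteq> 0"
      by (intro scale_factor_neq_0[OF \<alpha>]) auto
    then show ?case
      unfolding denom_def using cf_mat_scaled_column[OF t M, of k True "Suc k"] less.prems nz by simp
  qed
  then show ?thesis by (simp add: regular_def)
qed

text \<open>The last entry \<open>b\<^sub>N - b\<^sub>0\<close> is the lower right entry of \<open>M\<^bsub>N-1\<^esub>\<close>, whose lower left entry is \<open>1\<close>.\<close>

definition last_numer :: "nat \<Rightarrow> nat \<Rightarrow> (coord \<Rightarrow> complex) \<Rightarrow> complex" where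
  "last_numer n N x = snd (scaled_column n x False (N - 1) N)"

text \<open>For i = N the fractions for b_0 and b_N - b_0 are brought over a common
  denominator.\<close>

definition coeff_numer :: "nat \<Rightarrow> nat \<Rightarrow> nat \<Rightarrow> (coord \<Rightarrow> complex) \<Rightarrow> complex" where
  "coeff_numer g N i x = (if i < N then numer (g + 1) i x
     else numer (g + 1) 0 x * denom (g + 1) (N - 1) x + last_numer (g + 1) N x * denom (g + 1) 0 x)"

definition coeff_denom :: "nat \<Rightarrow> nat \<Rightarrow> nat \<Rightarrow> (coord \<Rightarrow> complex) \<Rightarrow> complex" where
  "coeff_denom g N i x = (if i < N then denom (g + 1) i x
     else denom (g + 1) 0 x * denom (g + 1) (N - 1) x)"

lemma polynomial_fun_coeff_numer: "polynomial_fun (coeff_numer g N i)"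
proof (cases "i < N")
  case True
  then show ?thesis
    using polynomial_fun_numer[of "g + 1" i] unfolding coeff_numer_def by simp
next
  case False
  have "polynomial_fun (\<lambda>x. numer (g + 1) 0 x * denom (g + 1) (N - 1) x +
      last_numer (g + 1) N x * denom (g + 1) 0 x)"
    using polynomial_fun_scaled_column unfolding last_numer_def
    by (intro polynomial_fun_intros polynomial_fun_numer polynomial_fun_denom) auto
  then show ?thesis using False unfolding coeff_numer_def by simp
qed

lemma polynomial_fun_coeff_denom: "polynomial_fun (coeff_denom g N i)"
proof (cases "i < N")
  case True
  then show ?thesis
    using polynomial_fun_denom[of "g + 1" i] unfolding coeff_denom_def by simp
next
  case False
  have "polynomial_fun (\<lambda>x. denom (g + 1) 0 x * denom (g + 1) (N - 1) x)"
    by (intro polynomial_fun_intros polynomial_fun_denom)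
  then show ?thesis using False unfolding coeff_denom_def by simp
qed

lemma coeff_denom_neq_0:
  assumes "N > 0" "regular g N \<alpha> t T"
  shows "coeff_denom g N i (coord_values \<alpha> t T) \<noteq> 0"
  using assms by (auto simp: coeff_denom_def regular_def)

lemma expansion_coeffs:
  assumes N: "N > 0" and t: "t \<in> triples g N \<alpha>" "procedure_root g N \<alpha> t T"
    and reg: "regular g N \<alpha> t T" and M: "cf_mat N \<alpha> b 0 = start_tuple t T" and i: "i \<le> N"
  shows "b i = coeff_numer g N i (coord_values \<alpha> t T) / coeff_denom g N i (coord_values \<alpha> t T)"
proof -
  let ?x = "coord_values \<alpha> t T"
  note col = cf_mat_scaled_column[OF t M]
  have b: "b k = numer (g + 1) k ?x / denom (g + 1) k ?x" if "k < N" for k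
  proof -
    have "numer (g + 1) k ?x = b k * denom (g + 1) k ?x"
      using that col[of k True "Suc k"]
      unfolding numer_def denom_def by (simp add: cf_mat_step column_at_step)
    then show ?thesis using reg that by (simp add: regular_def)
  qed
  have last: "b N - b 0 = last_numer (g + 1) N ?x / denom (g + 1) (N - 1) ?x"
  proof -
    obtain m where m: "N = Suc m" using N by (cases N) auto
    have "last_numer (g + 1) N ?x = (b N - b 0) * denom (g + 1) (N - 1) ?x"
      using col[of m True N] col[of m False N] cf_mat_step[of m N \<alpha> b] cf_mat_end[of N \<alpha> b]
      unfolding last_numer_def denom_def m by (simp add: column_at_step)
    then show ?thesis using reg N by (simp add: regular_def)
  qed
  show ?thesis
  proof (cases "i < N")
    case True
    then show ?thesis by (simp add: coeff_numer_def coeff_denom_def b)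
  next
    case False
    have "denom (g + 1) 0 ?x \<noteq> 0" "denom (g + 1) (N - 1) ?x \<noteq> 0"
      using reg N by (simp_all add: regular_def)
    moreover have "b N = numer (g + 1) 0 ?x / denom (g + 1) 0 ?x +
        last_numer (g + 1) N ?x / denom (g + 1) (N - 1) ?x"
      using last b[of 0] N by (simp add: algebra_simps)
    ultimately show ?thesis
      using False i by (simp add: coeff_numer_def coeff_denom_def add_frac_eq)
  qed
qed

section \<open>Existence and uniqueness of the factorisation\<close>

lemma periodic_coeffs_ext:
  assumes "N > 0" "periodic_coeffs N b" "periodic_coeffs N b'" "\<And>i. i \<le> N \<Longrightarrow> b i = b' i"
  shows "b = b'"
proof
  fix i show "b i = b' i"
  proof (induction i rule: less_induct)
    case (less i)
    show ?case
    proof (cases "i \<le> N")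
      case False
      then have "i - N \<ge> 1" "i - N + N = i" by auto
      then have "b i = b (i - N)" "b' i = b' (i - N)"
        using assms(2,3) unfolding periodic_coeffs_def by metis+
      then show ?thesis using less[of "i - N"] assms(1) False by simp
    qed (rule assms(4))
  qed
qed

lemma drop_points: "k < N \<Longrightarrow> drop k (points N \<alpha>) = \<alpha> (Suc k) # drop (Suc k) (points N \<alpha>)"
  unfolding points_def drop_map drop_upt add_0 by (simp add: upt_conv_Cons)

text \<open>The coefficients are prescribed by the rational formulas and the matrices are built
  along with them. A nonzero denominator gives b_n from the first column at \<alpha>_(n+1); the
  determinant vanishes there, so the second column obeys the same relation and the factor splits
  off.\<close>

lemma factorisation_exists:
  assumes N: "N = 2 * g + 1" and \<alpha>: "alpha_seq N \<alpha>"
    and t: "t \<in> triples g N \<alpha>" "procedure_root g N \<alpha> t T" and reg: "regular g N \<alpha> t T"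
  obtains b where "periodic_coeffs N b" "cf_mat N \<alpha> b 0 = start_tuple t T"
proof -
  let ?x = "coord_values \<alpha> t T"
  define b where "b k = numer (g + 1) k ?x / denom (g + 1) k ?x" for k
  have "\<exists>M. M 0 = start_tuple t T \<and> (\<forall>k<n. M k = step (b k) (\<alpha> (Suc k)) (M (Suc k))) \<and>
      M n \<in> shaped (drop n (points N \<alpha>))" if "n \<le> N" for n
    using that
  proof (induction n)
    case 0
    show ?case
      using start_tuple_in_shaped_iff[OF N] t by (intro exI[of _ "\<lambda>_. start_tuple t T"]) auto
  next
    case (Suc n)
    then obtain M where M: "M 0 = start_tuple t T"
        "\<And>k. k < n \<Longrightarrow> M k = step (b k) (\<alpha> (Suc k)) (M (Suc k))"
        "M n \<in> shaped (drop n (points N \<alpha>))"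
      by auto
    obtain p q r s where Mn: "M n = (p, q, r, s)" by (cases "M n")
    let ?a = "\<alpha> (Suc n)" and ?S = "scale_factor (g + 1) \<alpha> ?x n (Suc n)"
    have n: "n < N" using Suc.prems by simp
    have "scaled_column (g + 1) ?x True n (Suc n) = (?S * poly p ?a, ?S * poly r ?a)"
      using scaled_column_eq[OF degrees_le_triples[OF t] M(1,2) order_refl, where c = True and j = "Suc n"] by (simp add: Mn)
    then have nd: "numer (g + 1) n ?x = ?S * poly p ?a" "denom (g + 1) n ?x = ?S * poly r ?a"
      by (simp_all add: numer_def denom_def)
    moreover have "denom (g + 1) n ?x \<noteq> 0" using reg n by (simp add: regular_def)
    ultimately have r: "poly r ?a \<noteq> 0" and bn: "b n = poly p ?a / poly r ?a"
      by (auto simp: b_def)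
    have a: "?a \<in> set (drop n (points N \<alpha>))" by (simp add: drop_points[OF n])
    have "poly p ?a = b n * poly r ?a" "poly q ?a = b n * poly s ?a"
      using shaped_det_root[OF M(3)[unfolded Mn] a] r by (simp_all add: bn field_simps)
    then obtain M' where M': "M' \<in> shaped (remove1 ?a (drop n (points N \<alpha>)))" "M n = step (b n) ?a M'"
      using shaped_factor_at[OF M(3)[unfolded Mn] a] unfolding Mn by blast
    show ?case
    proof (intro exI[of _ "M(Suc n := M')"] conjI allI impI)
      fix k assume "k < Suc n"
      then show "(M(Suc n := M')) k = step (b k) (\<alpha> (Suc k)) ((M(Suc n := M')) (Suc k))"
        using M(2)[of k] M'(2) by (cases "k = n") auto
    qed (use M(1) M'(1) n in \<open>simp_all add: drop_points\<close>)
  qed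
  from this[of N] obtain M where M: "M 0 = start_tuple t T"
      "\<And>k. k < N \<Longrightarrow> M k = step (b k) (\<alpha> (Suc k)) (M (Suc k))" "M N \<in> shaped []"
    by auto
  obtain c where c: "M N = lprod [] c" using shaped_NilE[OF M(3)] .
  \<comment> \<open>Periodicity starts at index 1: the positive multiples of N carry b_0 + c, while
    index 0 keeps b_0.\<close>
  define b' where "b' i = (if i = 0 then b 0 else if i mod N = 0 then b 0 + c else b (i mod N))" for i
  have "periodic_coeffs N b'"
    by (simp add: periodic_coeffs_def b'_def)
  moreover have "cf_mat N \<alpha> b' k = M k" if "k \<le> N" for k
    using that
  proof (induction k rule: inc_induct)
    case base
    have "b' N - b' 0 = c" using N by (simp add: b'_def)
    then show ?case by (simp add: cf_mat_end c)
  next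
    case (step k)
    then show ?case using M(2)[of k] by (simp add: cf_mat_step b'_def)
  qed
  ultimately show ?thesis
    using that M(1) by simp
qed

lemma regular_unique_expansion:
  assumes N: "N = 2 * g + 1" and \<alpha>: "alpha_seq N \<alpha>"
    and t: "t \<in> triples g N \<alpha>" "procedure_root g N \<alpha> t T" and reg: "regular g N \<alpha> t T"
  shows "\<exists>!b. periodic_coeffs N b \<and> cf_mat N \<alpha> b 0 = start_tuple t T"
proof -
  have "N > 0" using N by simp
  obtain b where b: "periodic_coeffs N b" "cf_mat N \<alpha> b 0 = start_tuple t T"
    using factorisation_exists[OF assms] .
  have "b' = b" if "periodic_coeffs N b'" "cf_mat N \<alpha> b' 0 = start_tuple t T" for b'
    using expansion_coeffs[OF \<open>N > 0\<close> t reg that(2)] expansion_coeffs[OF \<open>N > 0\<close> t reg b(2)]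
    by (intro periodic_coeffs_ext[OF \<open>N > 0\<close> that(1) b(1)]) simp
  then show ?thesis using b by blast
qed

section \<open>Open dense sets of triples\<close>

lemma tendsto_fun_iff:
  fixes Y :: "nat \<Rightarrow> 'a \<Rightarrow> 'b :: topological_space"
  shows "(Y \<longlongrightarrow> f) F \<longleftrightarrow> (\<forall>i. ((\<lambda>k. Y k i) \<longlongrightarrow> f i) F)"
proof -
  have "(Y \<longlongrightarrow> f) F \<longleftrightarrow> limitin (product_topology (\<lambda>i. euclidean) UNIV) Y f F"
    by (simp add: euclidean_product_topology flip: limitin_canonical_iff)
  then show ?thesis
    by (simp add: limitin_componentwise limitin_canonical_iff)
qed

fun triple_coeffs ::
    "triple \<Rightarrow> (nat \<Rightarrow> complex) \<times> (nat \<Rightarrow> complex) \<times> (nat \<Rightarrow> complex)" where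
  "triple_coeffs (A, B, C) = (poly.coeff A, poly.coeff B, poly.coeff C)"

text \<open>The coordinates for T and \<alpha> are frozen at 0, so that convergence of all
  coordinates concerns A, B and C only.\<close>

fun triple_coord :: "triple \<Rightarrow> coord \<Rightarrow> complex" where
  "triple_coord t v = coord_values (\<lambda>_. 0) t 0 v"

definition triple_tendsto :: "(nat \<Rightarrow> triple) \<Rightarrow> triple \<Rightarrow> bool" where
  "triple_tendsto Y t \<longleftrightarrow> (\<forall>v. (\<lambda>k. triple_coord (Y k) v) \<longlonglongrightarrow> triple_coord t v)"

lemma triple_tendsto_iff: "triple_tendsto Y t \<longleftrightarrow> (\<lambda>k. triple_coeffs (Y k)) \<longlonglongrightarrow> triple_coeffs t"
proof -
  obtain A B C where t: "t = (A, B, C)" by (cases t)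
  define a b c where "a k = fst (Y k)" and "b k = fst (snd (Y k))" and "c k = snd (snd (Y k))" for k
  have Y: "Y k = (a k, b k, c k)" for k by (simp add: a_def b_def c_def)
  have "triple_tendsto Y t \<longleftrightarrow> (\<forall>i. (\<lambda>k. poly.coeff (a k) i) \<longlonglongrightarrow> poly.coeff A i) \<and>
      (\<forall>i. (\<lambda>k. poly.coeff (b k) i) \<longlonglongrightarrow> poly.coeff B i) \<and>
      (\<forall>i. (\<lambda>k. poly.coeff (c k) i) \<longlonglongrightarrow> poly.coeff C i)" (is "_ \<longleftrightarrow> ?R")
  proof
    assume L: "triple_tendsto Y t"
    have "(\<lambda>k. triple_coord (Y k) v) \<longlonglongrightarrow> triple_coord t v" for v
      using L by (simp add: triple_tendsto_def)
    from this[of "Coord_A _"] this[of "Coord_B _"] this[of "Coord_C _"] show ?R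
      by (simp add: Y t)
  next
    assume R: ?R
    have "(\<lambda>k. triple_coord (Y k) v) \<longlonglongrightarrow> triple_coord t v" for v
      using R by (cases v) (simp_all add: Y t)
    then show "triple_tendsto Y t" by (simp add: triple_tendsto_def)
  qed
  also have "\<dots> \<longleftrightarrow> (\<lambda>k. (poly.coeff (a k), poly.coeff (b k), poly.coeff (c k))) \<longlonglongrightarrow>
      (poly.coeff A, poly.coeff B, poly.coeff C)"
  proof
    assume L: "(\<lambda>k. (poly.coeff (a k), poly.coeff (b k), poly.coeff (c k))) \<longlonglongrightarrow>
      (poly.coeff A, poly.coeff B, poly.coeff C)"
    have "(\<lambda>k. poly.coeff (a k)) \<longlonglongrightarrow> poly.coeff A" "(\<lambda>k. poly.coeff (b k)) \<longlonglongrightarrow> poly.coeff B"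
      "(\<lambda>k. poly.coeff (c k)) \<longlonglongrightarrow> poly.coeff C"
      using tendsto_fst[OF L] tendsto_fst[OF tendsto_snd[OF L]] tendsto_snd[OF tendsto_snd[OF L]]
      unfolding fst_conv snd_conv by blast+
    then show ?R unfolding tendsto_fun_iff by blast
  next
    assume ?R
    then have "(\<lambda>k. poly.coeff (a k)) \<longlonglongrightarrow> poly.coeff A" "(\<lambda>k. poly.coeff (b k)) \<longlonglongrightarrow> poly.coeff B"
      "(\<lambda>k. poly.coeff (c k)) \<longlonglongrightarrow> poly.coeff C"
      unfolding tendsto_fun_iff by blast+
    then show "(\<lambda>k. (poly.coeff (a k), poly.coeff (b k), poly.coeff (c k))) \<longlonglongrightarrow>
      (poly.coeff A, poly.coeff B, poly.coeff C)"
      by (intro tendsto_Pair)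
  qed
  finally show ?thesis by (simp add: Y t)
qed

lemma coeff_topology_eq: "coeff_topology V = pullback_topology V triple_coeffs euclidean"
proof -
  have "(\<lambda>(A, B, C). (poly.coeff A, poly.coeff B, poly.coeff C)) = triple_coeffs"
    by auto
  then show ?thesis unfolding coeff_topology_def by simp
qed

lemma topspace_coeff_topology [simp]: "topspace (coeff_topology V) = V"
  by (simp add: coeff_topology_eq topspace_pullback_topology)

text \<open>Sequences suffice because the space of coefficient sequences is first countable. U is
  recovered as the preimage of the complement of the closure of the image of V - U.\<close>

lemma openin_coeff_topologyI:
  assumes "U \<subseteq> V"
    and "\<And>Y t. (\<And>k. Y k \<in> V - U) \<Longrightarrow> t \<in> V \<Longrightarrow> triple_tendsto Y t \<Longrightarrow> t \<notin> U"
  shows "openin (coeff_topology V) U"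
proof -
  let ?W = "- closure (triple_coeffs ` (V - U))"
  have limit: "t \<notin> U" if t: "t \<in> V" "triple_coeffs t \<in> closure (triple_coeffs ` (V - U))" for t
  proof -
    obtain y where y: "\<forall>k. y k \<in> triple_coeffs ` (V - U)" and lim: "y \<longlonglongrightarrow> triple_coeffs t"
      using iffD1[OF closure_sequential t(2)] by (elim exE conjE) (rule that)
    have "\<forall>k. \<exists>s. s \<in> V - U \<and> y k = triple_coeffs s"
    proof
      fix k
      obtain s where s: "y k = triple_coeffs s" "s \<in> V - U"
        using spec[OF y] by (rule imageE)
      show "\<exists>s. s \<in> V - U \<and> y k = triple_coeffs s"
        by (rule exI[of _ s], rule conjI[OF s(2) s(1)])
    qed
    from choice[OF this] obtain Y where Y: "\<forall>k. Y k \<in> V - U \<and> y k = triple_coeffs (Y k)"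
      by (elim exE) (rule that)
    have Y_in: "Y k \<in> V - U" for k by (rule conjunct1[OF spec[OF Y]])
    have y_eq: "y = (\<lambda>k. triple_coeffs (Y k))" by (rule ext) (rule conjunct2[OF spec[OF Y]])
    have "triple_tendsto Y t"
      unfolding triple_tendsto_iff using lim unfolding y_eq .
    then show ?thesis by (rule assms(2)[OF Y_in t(1)])
  qed
  have iff: "t \<in> U \<longleftrightarrow> triple_coeffs t \<in> ?W \<and> t \<in> V" for t
  proof (cases "t \<in> V")
    case True
    have "triple_coeffs t \<in> closure (triple_coeffs ` (V - U))" if "t \<notin> U"
      by (rule subsetD[OF closure_subset], rule imageI) (use that True in simp)
    then show ?thesis using limit[OF True] True unfolding Compl_iff by blast
  qed (use assms(1) in auto)
  have eq: "U = triple_coeffs -` ?W \<inter> V"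
  proof (rule Set.set_eqI)
    fix t show "t \<in> U \<longleftrightarrow> t \<in> triple_coeffs -` ?W \<inter> V"
      unfolding Int_iff vimage_eq by (rule iff)
  qed
  show ?thesis
    unfolding coeff_topology_eq openin_pullback_topology
  proof (intro exI conjI)
    show "openin euclidean ?W" by (simp add: open_Compl)
  qed (rule eq)
qed

lemma dense_coeff_topologyI:
  assumes "U \<subseteq> V" and "\<And>t. t \<in> V \<Longrightarrow> \<exists>Y. (\<forall>k. Y k \<in> U) \<and> triple_tendsto Y t"
  shows "coeff_topology V closure_of U = V"
proof
  show "coeff_topology V closure_of U \<subseteq> V"
    using closure_of_subset_topspace[of "coeff_topology V" U] by simp
  show "V \<subseteq> coeff_topology V closure_of U"
  proof
    fix t assume t: "t \<in> V"
    then obtain Y where Y: "\<And>k. Y k \<in> U" "triple_tendsto Y t"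
      using assms(2) by blast
    have "\<exists>y. y \<in> U \<and> y \<in> O'" if O': "t \<in> O'" "openin (coeff_topology V) O'" for O'
    proof -
      obtain W where W: "open W" "O' = triple_coeffs -` W \<inter> V"
        using O'(2) unfolding coeff_topology_eq openin_pullback_topology by auto
      have "eventually (\<lambda>k. triple_coeffs (Y k) \<in> W) sequentially"
        using Y(2) W O'(1) unfolding triple_tendsto_iff by (auto intro: topological_tendstoD)
      then obtain k where "triple_coeffs (Y k) \<in> W"
        using eventually_happens'[OF sequentially_bot] by blast
      then show ?thesis using Y(1) W(2) assms(1) by blast
    qed
    then show "t \<in> coeff_topology V closure_of U"
      unfolding in_closure_of using t by simp
  qed
qed

lemma polynomial_fun_tendsto:
  assumes "polynomial_fun G" "\<And>v. (\<lambda>k. x k v) \<longlonglongrightarrow> y v"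
  shows "(\<lambda>k. G (x k)) \<longlonglongrightarrow> G y"
  using assms by induction (auto intro: tendsto_intros)

section \<open>Compactness arguments for roots and coefficients\<close>

lemma convergent_subsequence_finite:
  fixes f :: "nat \<Rightarrow> nat \<Rightarrow> complex"
  assumes "\<And>i. i < n \<Longrightarrow> bounded (range (f i))"
  shows "\<exists>r. strict_mono r \<and> (\<forall>i<n. convergent (f i \<circ> r))"
  using assms
proof (induction n)
  case 0
  then show ?case by (auto intro: strict_mono_id)
next
  case (Suc n)
  have "\<exists>r. strict_mono r \<and> (\<forall>i<n. convergent (f i \<circ> r))"
    using Suc.prems by (intro Suc.IH) simp
  then obtain r where r: "strict_mono r" "\<And>i. i < n \<Longrightarrow> convergent (f i \<circ> r)" by blast
  have "bounded (range (f n \<circ> r))"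
    using Suc.prems[of n] by (rule bounded_subset) auto
  then obtain l r' where r': "strict_mono r'" "((f n \<circ> r) \<circ> r') \<longlonglongrightarrow> l"
    using bounded_imp_convergent_subsequence by blast
  have "convergent (f i \<circ> (r \<circ> r'))" if "i < Suc n" for i
  proof (cases "i = n")
    case True
    then show ?thesis using r'(2) by (auto simp: convergent_def o_assoc)
  next
    case False
    then have "convergent ((f i \<circ> r) \<circ> r')"
      using that r' by (intro convergent_subseq_convergent r(2)) auto
    then show ?thesis by (simp add: o_assoc)
  qed
  then show ?case
    using strict_mono_o[OF r(1) r'(1)] by blast
qed

lemma bounded_range_cmult:
  fixes f :: "'a \<Rightarrow> complex"
  shows "bounded (range f) \<Longrightarrow> bounded (range (\<lambda>k. c * f k))"
  using bounded_linear_image[OF _ bounded_linear_mult_right, of "range f" c] by (simp add: image_image)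

text \<open>Induction on the degree, dividing off one linear factor at a point z0 of S; an infinite
  S survives the removal of z0.\<close>

lemma bounded_coeffs_of_values:
  fixes T :: "nat \<Rightarrow> complex poly"
  assumes "infinite S" "\<And>z. z \<in> S \<Longrightarrow> bounded (range (\<lambda>k. poly (T k) z))"
    and "\<And>k. Polynomial.degree (T k) \<le> n"
  shows "bounded (range (\<lambda>k. poly.coeff (T k) i))"
  using assms
proof (induction n arbitrary: S T i)
  case 0
  then have "T k = [:poly.coeff (T k) 0:]" for k
    by (metis degree_0_id le_zero_eq)
  then have T: "poly (T k) z = poly.coeff (T k) 0" for k z
    by (metis mult_zero_right poly_0 poly_pCons add_0_right)
  obtain z where "z \<in> S" using 0(1) by fastforce
  then show ?case
    using 0(2)[of z] 0(3) by (cases "i = 0") (auto simp: T coeff_eq_0)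
next
  case (Suc n)
  obtain z0 where z0: "z0 \<in> S" using Suc(2) by fastforce
  define Q where "Q k = synthetic_div (T k) z0" for k
  have T: "T k = lin z0 * Q k + [:poly (T k) z0:]" for k
    unfolding Q_def lin_def synthetic_div_correct' ..
  have "bounded (range (\<lambda>k. poly (Q k) z))" if z: "z \<in> S - {z0}" for z
  proof -
    have "poly (Q k) z = inverse (z - z0) * (poly (T k) z - poly (T k) z0)" for k
      using z arg_cong[OF T[of k], of "\<lambda>p. poly p z"] by (simp add: field_simps)
    moreover have "bounded (range (\<lambda>k. inverse (z - z0) * (poly (T k) z - poly (T k) z0)))"
      using z z0 by (intro bounded_range_cmult bounded_minus_comp Suc(3)) auto
    ultimately show ?thesis by simp
  qed
  then have bQ: "bounded (range (\<lambda>k. poly.coeff (Q k) j))" for j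
    using Suc(2,4) by (intro Suc.IH[of "S - {z0}"])
      (auto simp: Q_def degree_synthetic_div le_diff_conv)
  have b0: "bounded (range (\<lambda>k. if i = 0 then 0 else poly.coeff (Q k) (i - 1)))"
    using bQ by (cases "i = 0") auto
  have b1: "bounded (range (\<lambda>k. poly.coeff [:poly (T k) z0:] i))"
    using Suc(3)[OF z0] by (cases i) auto
  have "poly.coeff (T k) i = (if i = 0 then 0 else poly.coeff (Q k) (i - 1)) -
      z0 * poly.coeff (Q k) i + poly.coeff [:poly (T k) z0:] i" for k
    by (subst T) (simp only: coeff_add coeff_lin_mult)
  then have eq: "(\<lambda>k. poly.coeff (T k) i) = (\<lambda>k. (if i = 0 then 0 else poly.coeff (Q k) (i - 1)) -
      z0 * poly.coeff (Q k) i + poly.coeff [:poly (T k) z0:] i)"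
    by blast
  show ?case
    unfolding eq by (intro bounded_plus_comp bounded_minus_comp bounded_range_cmult b0 b1 bQ)
qed

text \<open>For norm z > 1, isolating z^n bounds norm z by the sum of the norms of the lower
  coefficients; the summand 1 covers the unit disc.\<close>

lemma monic_root_bound:
  fixes p :: "complex poly"
  assumes "Polynomial.degree p = n" "Polynomial.lead_coeff p = 1" "poly p z = 0"
  shows "norm z \<le> 1 + (\<Sum>i<n. norm (poly.coeff p i))"
proof (rule ccontr)
  assume "\<not> ?thesis"
  then have z: "norm z > 1 + (\<Sum>i<n. norm (poly.coeff p i))" by simp
  moreover have nonneg: "(\<Sum>i<n. norm (poly.coeff p i)) \<ge> 0" by (intro sum_nonneg) auto
  ultimately have z1: "norm z > 1" by linarith
  have "{..n} = insert n {..<n}" by auto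
  then have "poly p z = z ^ n + (\<Sum>i<n. poly.coeff p i * z ^ i)"
    using assms(1,2) by (simp add: poly_altdef)
  then have "norm (z ^ n) = norm (\<Sum>i<n. poly.coeff p i * z ^ i)"
    using assms(3) by (metis add_eq_0_iff norm_minus_cancel)
  also have "\<dots> \<le> (\<Sum>i<n. norm (poly.coeff p i) * norm z ^ (n - 1))"
    using z1 by (intro sum_norm_le) (auto simp: norm_mult norm_power intro!: mult_left_mono power_increasing)
  also have "\<dots> = (\<Sum>i<n. norm (poly.coeff p i)) * norm z ^ (n - 1)"
    by (simp add: sum_distrib_right)
  finally have le: "norm z ^ n \<le> (\<Sum>i<n. norm (poly.coeff p i)) * norm z ^ (n - 1)"
    by (simp add: norm_power)
  show False
  proof (cases n)
    case 0
    then show ?thesis using le by simp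
  next
    case (Suc m)
    then have "norm z * norm z ^ m \<le> (\<Sum>i<n. norm (poly.coeff p i)) * norm z ^ m"
      using le by simp
    then have "norm z \<le> (\<Sum>i<n. norm (poly.coeff p i))"
    proof (rule mult_right_le_imp_le)
      show "0 < norm z ^ m"
        by (rule zero_less_power) (use z1 in linarith)
    qed
    then show ?thesis using z by linarith
  qed
qed

definition no_common_root :: "triple \<Rightarrow> bool" where
  "no_common_root = (\<lambda>(A, B, C). \<forall>z. poly A z = 0 \<longrightarrow> poly C z \<noteq> 0)"

lemma poly_tendsto:
  fixes p :: "nat \<Rightarrow> complex poly"
  assumes "\<And>k. Polynomial.degree (p k) \<le> n" "Polynomial.degree q \<le> n"
    and "\<And>i. (\<lambda>k. poly.coeff (p k) i) \<longlonglongrightarrow> poly.coeff q i" "z \<longlonglongrightarrow> w"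
  shows "(\<lambda>k. poly (p k) (z k)) \<longlonglongrightarrow> poly q w"
  using assms by (simp add: poly_eq_sum_le[of _ n]) (intro tendsto_intros)

lemma triple_tendstoD:
  assumes "triple_tendsto Y t"
  shows "(\<lambda>k. poly.coeff (fst (Y k)) i) \<longlonglongrightarrow> poly.coeff (fst t) i"
    "(\<lambda>k. poly.coeff (fst (snd (Y k))) i) \<longlonglongrightarrow> poly.coeff (fst (snd t)) i"
    "(\<lambda>k. poly.coeff (snd (snd (Y k))) i) \<longlonglongrightarrow> poly.coeff (snd (snd t)) i"
proof -
  have eq: "triple_coord s (Coord_A i) = poly.coeff (fst s) i"
    "triple_coord s (Coord_B i) = poly.coeff (fst (snd s)) i"
    "triple_coord s (Coord_C i) = poly.coeff (snd (snd s)) i" for s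
    by (cases s; simp)+
  show "(\<lambda>k. poly.coeff (fst (Y k)) i) \<longlonglongrightarrow> poly.coeff (fst t) i"
    "(\<lambda>k. poly.coeff (fst (snd (Y k))) i) \<longlonglongrightarrow> poly.coeff (fst (snd t)) i"
    "(\<lambda>k. poly.coeff (snd (snd (Y k))) i) \<longlonglongrightarrow> poly.coeff (snd (snd t)) i"
    using assms unfolding triple_tendsto_def eq[symmetric] by blast+
qed

lemma triples_props:
  assumes "t \<in> triples g N \<alpha>"
  shows "Polynomial.degree (fst t) = g" "Polynomial.lead_coeff (fst t) = 1"
    "Polynomial.degree (fst (snd t)) \<le> g" "Polynomial.degree (snd (snd t)) = g + 1"
  using assms by (auto simp: triples_def)

text \<open>A is monic, so its roots stay bounded along a convergent sequence of triples, and common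
  roots accumulate at a common root of the limit.\<close>

lemma openin_no_common_root:
  assumes V: "V \<subseteq> triples g N \<alpha>"
  shows "openin (coeff_topology V) {t \<in> V. no_common_root t}"
proof (rule openin_coeff_topologyI)
  fix Y t
  assume Y: "\<And>k. Y k \<in> V - {t \<in> V. no_common_root t}" and t: "t \<in> V" and lim: "triple_tendsto Y t"
  define A C where "A k = fst (Y k)" and "C k = snd (snd (Y k))" for k
  have Xk: "Y k \<in> triples g N \<alpha>" for k using Y V by blast
  have "\<exists>z. poly (A k) z = 0 \<and> poly (C k) z = 0" for k
    using Y[of k] by (auto simp: no_common_root_def A_def C_def split: prod.splits)
  then obtain z where z: "\<And>k. poly (A k) (z k) = 0" "\<And>k. poly (C k) (z k) = 0" by metis
  note limA = triple_tendstoD(1)[OF lim, folded A_def] and limC = triple_tendstoD(3)[OF lim, folded C_def]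
  have "(\<lambda>k. 1 + (\<Sum>i<g. norm (poly.coeff (A k) i))) \<longlonglongrightarrow> 1 + (\<Sum>i<g. norm (poly.coeff (fst t) i))"
    by (intro tendsto_intros limA)
  then have "bounded (range (\<lambda>k. 1 + (\<Sum>i<g. norm (poly.coeff (A k) i))))"
    by (rule convergent_imp_bounded)
  then obtain K where K: "\<And>k. norm (1 + (\<Sum>i<g. norm (poly.coeff (A k) i))) \<le> K"
    unfolding bounded_iff by blast
  have "norm (z k) \<le> K" for k
  proof -
    have "norm (z k) \<le> 1 + (\<Sum>i<g. norm (poly.coeff (A k) i))"
      using monic_root_bound[OF _ _ z(1)] triples_props[OF Xk] by (simp add: A_def)
    then show ?thesis using K[of k] by simp
  qed
  then have "bounded (range z)" unfolding bounded_iff by blast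
  then obtain w r where r: "strict_mono r" "(z \<circ> r) \<longlonglongrightarrow> w"
    using bounded_imp_convergent_subsequence by blast
  have "(\<lambda>k. poly (A (r k)) ((z \<circ> r) k)) \<longlonglongrightarrow> poly (fst t) w"
    using triples_props[OF Xk] triples_props[OF subsetD[OF V t]] LIMSEQ_subseq_LIMSEQ[OF limA r(1)]
    by (intro poly_tendsto[where n = g] r(2)) (auto simp: A_def o_def)
  then have "poly (fst t) w = 0"
    by (simp add: z LIMSEQ_const_iff)
  moreover have "(\<lambda>k. poly (C (r k)) ((z \<circ> r) k)) \<longlonglongrightarrow> poly (snd (snd t)) w"
    using triples_props[OF Xk] triples_props[OF subsetD[OF V t]] LIMSEQ_subseq_LIMSEQ[OF limC r(1)]
    by (intro poly_tendsto[where n = "g + 1"] r(2)) (auto simp: C_def o_def)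
  then have "poly (snd (snd t)) w = 0"
    by (simp add: z LIMSEQ_const_iff)
  ultimately show "t \<notin> {t \<in> V. no_common_root t}"
    by (auto simp: no_common_root_def split: prod.splits)
qed auto

lemma poly_discr:
  "poly (discr t) z = poly (fst (snd t)) z ^ 2 - poly (fst t) z * poly (snd (snd t)) z"
  by (cases t) simp

text \<open>
  The square roots \<open>T\<close> depend continuously on the triple as a set; bounded coefficients give a
  convergent subsequence, so no choice of branch is needed.
\<close>

lemma openin_all_roots:
  assumes V: "V \<subseteq> triples g N \<alpha>" and G: "polynomial_fun G" and K: "polynomial_fun K"
  shows "openin (coeff_topology V) {t \<in> V. \<forall>T. procedure_root g N \<alpha> t T \<longrightarrow>
    K (coord_values \<alpha> t T) = 0 \<longrightarrow> G (coord_values \<alpha> t T) \<noteq> 0}" (is "openin _ ?U")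
proof (rule openin_coeff_topologyI)
  fix Y t
  assume Y: "\<And>k. Y k \<in> V - ?U" and t: "t \<in> V" and lim: "triple_tendsto Y t"
  have Xk: "Y k \<in> triples g N \<alpha>" for k using Y V by blast
  have "\<exists>T. procedure_root g N \<alpha> (Y k) T \<and> K (coord_values \<alpha> (Y k) T) = 0 \<and>
      G (coord_values \<alpha> (Y k) T) = 0" for k
    using Y[of k] by blast
  then obtain T where T: "\<And>k. procedure_root g N \<alpha> (Y k) (T k)"
      "\<And>k. K (coord_values \<alpha> (Y k) (T k)) = 0" "\<And>k. G (coord_values \<alpha> (Y k) (T k)) = 0"
    by metis
  have degT: "Polynomial.degree (T k) \<le> g" and sqT: "T k ^ 2 = discr (Y k) - alpha_poly N \<alpha>" for k
    using T(1) by (simp_all add: procedure_root_def)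
  note lims = triple_tendstoD[OF lim]
  have lim_discr: "(\<lambda>k. poly (discr (Y k) - alpha_poly N \<alpha>) z) \<longlonglongrightarrow> poly (discr t - alpha_poly N \<alpha>) z" for z
    unfolding poly_diff poly_discr
    using triples_props[OF Xk] triples_props[OF subsetD[OF V t]]
    by (intro tendsto_intros poly_tendsto[where n = "g + 1"] lims) (auto intro: le_SucI)
  have "bounded (range (\<lambda>k. poly (T k) z))" for z
  proof -
    have "bounded (range (\<lambda>k. poly (discr (Y k) - alpha_poly N \<alpha>) z))"
      by (rule convergent_imp_bounded[OF lim_discr])
    then obtain B where B: "\<And>k. norm (poly (discr (Y k) - alpha_poly N \<alpha>) z) \<le> B"
      unfolding bounded_iff by blast
    have "norm (poly (T k) z) \<le> 1 + B" for k
    proof -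
      have "norm (poly (T k) z) ^ 2 \<le> B"
        using B[of k] unfolding sqT[symmetric] by (simp add: norm_power)
      moreover have "norm (poly (T k) z) \<le> 1 + norm (poly (T k) z) ^ 2"
        using zero_le_power2[of "norm (poly (T k) z) - 1"] norm_ge_zero[of "poly (T k) z"]
        unfolding power2_diff mult_1_right one_power2 by linarith
      ultimately show ?thesis by linarith
    qed
    then show ?thesis unfolding bounded_iff by blast
  qed
  then have "bounded (range (\<lambda>k. poly.coeff (T k) i))" for i
    using bounded_coeffs_of_values[of UNIV T g i] degT infinite_UNIV_char_0 by blast
  then obtain r where r: "strict_mono r" "\<And>i. i < Suc g \<Longrightarrow> convergent ((\<lambda>k. poly.coeff (T k) i) \<circ> r)"
    using convergent_subsequence_finite[of "Suc g" "\<lambda>i k. poly.coeff (T k) i"] by blast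
  then have "\<forall>i. \<exists>l. i \<le> g \<longrightarrow> (\<lambda>k. poly.coeff (T (r k)) i) \<longlonglongrightarrow> l"
    by (auto simp: convergent_def o_def less_Suc_eq_le)
  then obtain l where l: "\<And>i. i \<le> g \<Longrightarrow> (\<lambda>k. poly.coeff (T (r k)) i) \<longlonglongrightarrow> l i" by metis
  define T' where "T' = (\<Sum>i\<le>g. Polynomial.monom (l i) i)"
  have coeff_T': "poly.coeff T' i = (if i \<le> g then l i else 0)" for i
    by (simp add: T'_def coeff_sum)
  have limT: "(\<lambda>k. poly.coeff (T (r k)) i) \<longlonglongrightarrow> poly.coeff T' i" for i
  proof (cases "i \<le> g")
    case False
    then have "poly.coeff (T (r k)) i = 0" for k using degT[of "r k"] by (intro coeff_eq_0) auto
    then show ?thesis using False by (simp add: coeff_T')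
  qed (simp add: coeff_T' l)
  have degT': "Polynomial.degree T' \<le> g" by (rule degree_le) (simp add: coeff_T')
  have "T' ^ 2 = discr t - alpha_poly N \<alpha>"
  proof (rule poly_ext)
    fix z
    have "(\<lambda>k. poly (T (r k) ^ 2) z) \<longlonglongrightarrow> poly (T' ^ 2) z"
      unfolding poly_power using degT degT' by (intro tendsto_intros poly_tendsto[where n = g] limT) auto
    moreover have "(\<lambda>k. poly (T (r k) ^ 2) z) \<longlonglongrightarrow> poly (discr t - alpha_poly N \<alpha>) z"
      unfolding sqT using LIMSEQ_subseq_LIMSEQ[OF lim_discr r(1)] by (simp add: o_def)
    ultimately show "poly (T' ^ 2) z = poly (discr t - alpha_poly N \<alpha>) z"
      by (rule LIMSEQ_unique)
  qed
  then have root: "procedure_root g N \<alpha> t T'"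
    using degT' by (simp add: procedure_root_def)
  have coords: "(\<lambda>k. coord_values \<alpha> (Y (r k)) (T (r k)) v) \<longlonglongrightarrow> coord_values \<alpha> t T' v" for v
  proof -
    obtain A B C where t': "t = (A, B, C)" by (cases t)
    define a b c where "a k = fst (Y k)" and "b k = fst (snd (Y k))" and "c k = snd (snd (Y k))" for k
    have Yt: "Y k = (a k, b k, c k)" for k by (simp add: a_def b_def c_def)
    show ?thesis
      using LIMSEQ_subseq_LIMSEQ[OF lims(1) r(1)] LIMSEQ_subseq_LIMSEQ[OF lims(2) r(1)]
        LIMSEQ_subseq_LIMSEQ[OF lims(3) r(1)] limT
      by (cases v) (simp_all add: Yt t' o_def)
  qed
  have "K (coord_values \<alpha> t T') = 0"
    using polynomial_fun_tendsto[OF K, where x = "\<lambda>k. coord_values \<alpha> (Y (r k)) (T (r k))", OF coords] unfolding T(2) by (simp add: LIMSEQ_const_iff)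
  moreover have "G (coord_values \<alpha> t T') = 0"
    using polynomial_fun_tendsto[OF G, where x = "\<lambda>k. coord_values \<alpha> (Y (r k)) (T (r k))", OF coords] unfolding T(3) by (simp add: LIMSEQ_const_iff)
  ultimately show "t \<notin> ?U" using root by blast
qed auto

section \<open>From nearby matrices to convergent triples\<close>

definition mat_coords :: "(nat \<Rightarrow> complex) \<Rightarrow> mat2 \<Rightarrow> coord \<Rightarrow> complex" where
  "mat_coords \<alpha> M = coord_values \<alpha> (triple_of M) (half_trace M)"

lemma near_tendsto:
  assumes "\<And>k. near (inverse (real (Suc k))) (F k) M"
  shows "(\<lambda>k. mat_coords \<alpha> (F k) v) \<longlonglongrightarrow> mat_coords \<alpha> M v"
proof -
  obtain p q r s where M: "M = (p, q, r, s)" by (cases M)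
  define fp fq fr fs where "fp k = fst (F k)" and "fq k = fst (snd (F k))"
    and "fr k = fst (snd (snd (F k)))" and "fs k = snd (snd (snd (F k)))" for k
  have F: "F k = (fp k, fq k, fr k, fs k)" for k by (simp add: fp_def fq_def fr_def fs_def)
  have lim: "(\<lambda>k. poly.coeff (f k) i) \<longlonglongrightarrow> poly.coeff u i"
    if "\<And>k. near_poly (inverse (real (Suc k))) (f k) u" for f u i
  proof (rule LIM_zero_cancel[OF Lim_null_comparison])
    show "\<forall>\<^sub>F k in sequentially. norm (poly.coeff (f k) i - poly.coeff u i) \<le> inverse (real (Suc k))"
      using that by (auto simp: near_poly_def less_imp_le)
    show "(\<lambda>k. inverse (real (Suc k))) \<longlonglongrightarrow> 0" by (rule LIMSEQ_inverse_real_of_nat)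
  qed
  have "(\<lambda>k. poly.coeff (fp k) i) \<longlonglongrightarrow> poly.coeff p i" "(\<lambda>k. poly.coeff (fq k) i) \<longlonglongrightarrow> poly.coeff q i"
    "(\<lambda>k. poly.coeff (fr k) i) \<longlonglongrightarrow> poly.coeff r i" "(\<lambda>k. poly.coeff (fs k) i) \<longlonglongrightarrow> poly.coeff s i" for i
    using assms by (intro lim; simp add: F M)+
  then show ?thesis
    by (cases v) (auto simp: mat_coords_def F M intro!: tendsto_intros)
qed

lemma adherent_sequence:
  assumes "M \<in> adherent S"
  obtains F where "\<And>k. F k \<in> S" "\<And>v. (\<lambda>k. mat_coords \<alpha> (F k) v) \<longlonglongrightarrow> mat_coords \<alpha> M v"
proof -
  have "\<exists>M'. M' \<in> S \<and> near (inverse (real (Suc k))) M' M" for k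
    using adherentD[OF assms, of "inverse (real (Suc k))"] by auto
  then obtain F where F: "\<And>k. F k \<in> S" "\<And>k. near (inverse (real (Suc k))) (F k) M" by metis
  then show ?thesis using that near_tendsto[OF F(2)] by blast
qed

lemma triple_tendsto_mat:
  assumes "\<And>v. (\<lambda>k. mat_coords \<alpha> (F k) v) \<longlonglongrightarrow> mat_coords \<alpha> M v"
  shows "triple_tendsto (\<lambda>k. triple_of (F k)) (triple_of M)"
  unfolding triple_tendsto_def
proof
  have eq: "triple_coord (triple_of M) v =
      (case v of Coord_T i \<Rightarrow> 0 | Coord_alpha i \<Rightarrow> 0 | _ \<Rightarrow> mat_coords \<alpha> M v)" for M v
    by (cases M; cases v) (simp_all add: mat_coords_def)
  fix v
  show "(\<lambda>k. triple_coord (triple_of (F k)) v) \<longlonglongrightarrow> triple_coord (triple_of M) v"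
    unfolding eq using assms[of v] by (cases v) simp_all
qed

lemma near_neq_0:
  assumes "polynomial_fun G" "G (mat_coords \<alpha> M) \<noteq> 0"
  obtains d where "d > 0" "\<And>M'. near d M' M \<Longrightarrow> G (mat_coords \<alpha> M') \<noteq> 0"
proof (rule ccontr)
  assume no: "\<not> thesis"
  have "\<exists>M'. near (inverse (real (Suc k))) M' M \<and> G (mat_coords \<alpha> M') = 0" for k
    using no that[of "inverse (real (Suc k))"] by fastforce
  then obtain F where F: "\<And>k. near (inverse (real (Suc k))) (F k) M" "\<And>k. G (mat_coords \<alpha> (F k)) = 0"
    by metis
  have "G (mat_coords \<alpha> M) = 0"
    using polynomial_fun_tendsto[OF assms(1), where x = "\<lambda>k. mat_coords \<alpha> (F k)", OF near_tendsto[OF F(1)]]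
    unfolding F(2) by (simp add: LIMSEQ_const_iff)
  then show False using assms(2) by simp
qed

lemma polynomial_fun_prod:
  "(\<And>i. i \<in> I \<Longrightarrow> polynomial_fun (f i)) \<Longrightarrow> polynomial_fun (\<lambda>x. \<Prod>i\<in>I. f i x)"
  by (induction I rule: infinite_finite_induct) (auto intro: polynomial_fun.intros)

section \<open>Generic triples\<close>

text \<open>Gathers the conditions that depend on T into a single polynomial function, so that one
  openness lemma handles all of them.\<close>

definition good_fun :: "nat \<Rightarrow> nat \<Rightarrow> (coord \<Rightarrow> complex) \<Rightarrow> complex" where
  "good_fun g N x = (\<Prod>k<N. denom (g + 1) k x) * eval_coords (g + 1) x Coord_T N"

lemma polynomial_fun_good_fun: "polynomial_fun (good_fun g N)"
  unfolding good_fun_def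
  by (intro polynomial_fun.mult polynomial_fun_prod polynomial_fun_eval_coords polynomial_fun_denom)

lemma eval_coords_T:
  "Polynomial.degree T \<le> n \<Longrightarrow> eval_coords n (coord_values \<alpha> t T) Coord_T j = poly T (\<alpha> j)"
  by (cases t) (simp add: eval_coords_def flip: poly_eq_sum_le)

lemma eval_coords_B:
  "Polynomial.degree B \<le> n \<Longrightarrow> eval_coords n (coord_values \<alpha> (A, B, C) T) Coord_B j = poly B (\<alpha> j)"
  by (simp add: eval_coords_def flip: poly_eq_sum_le)

lemma good_fun_iff:
  assumes "procedure_root g N \<alpha> t T"
  shows "good_fun g N (coord_values \<alpha> t T) \<noteq> 0 \<longleftrightarrow> regular g N \<alpha> t T \<and> poly T (\<alpha> N) \<noteq> 0"
proof -
  have "Polynomial.degree T \<le> g + 1" using assms by (simp add: procedure_root_def)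
  then show ?thesis
    unfolding good_fun_def regular_def eval_coords_T[OF \<open>Polynomial.degree T \<le> g + 1\<close>] by auto
qed

lemma fst_column_at: "fst (column_at True M z) = poly (fst M) z"
  by (cases M) simp

definition good_mats :: "nat \<Rightarrow> nat \<Rightarrow> (nat \<Rightarrow> complex) \<Rightarrow> mat2 set" where
  "good_mats g N \<alpha> = {M \<in> shaped (points N \<alpha>).
     no_common_root (triple_of M) \<and> good_fun g N (mat_coords \<alpha> M) \<noteq> 0}"

lemma shaped_triple_of:
  assumes "N = 2 * g + 1" "M \<in> shaped (points N \<alpha>)"
  shows "triple_of M \<in> triples g N \<alpha>" "procedure_root g N \<alpha> (triple_of M) (half_trace M)"
  using start_tuple_in_shaped_iff[OF assms(1), of "triple_of M" "half_trace M" \<alpha>] assms(2)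
  by (simp_all add: start_tuple_triple_of)

text \<open>The lower left entry of M_k is the upper left entry of M_(k+1), which genericity keeps
  nonzero at \<alpha>_(k+1); hence no denominator vanishes.\<close>

lemma lprod_in_good_mats:
  assumes N: "N = 2 * g + 1" and \<alpha>: "alpha_seq N \<alpha>" and ps: "map snd ps = points N \<alpha>"
    and gen: "generic (set (points N \<alpha>)) ps c" and nd: "nondegenerate (\<alpha> N) (lprod ps c)"
  shows "lprod ps c \<in> good_mats g N \<alpha>"
proof -
  let ?M = "lprod ps c"
  have shaped: "?M \<in> shaped (points N \<alpha>)"
    using lprod_in_shaped[of ps c] by (simp add: ps)
  note t = shaped_triple_of[OF N shaped]
  \<comment> \<open>\<open>cf_mat\<close> reads b_0, ..., b_N only; the value at N is chosen to give
    b_N - b_0 = c.\<close>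
  define b where "b i = (if i < N then fst (ps ! i) else fst (ps ! 0) + c)" for i
  have len: "length ps = N" using arg_cong[OF ps, of length] by simp
  have "map (\<lambda>i. (b i, \<alpha> (Suc i))) [0..<N] = ps"
  proof (rule nth_equalityI)
    fix i assume "i < length (map (\<lambda>i. (b i, \<alpha> (Suc i))) [0..<N])"
    then have i: "i < N" by simp
    have "snd (ps ! i) = points N \<alpha> ! i" using arg_cong[OF ps, of "\<lambda>l. l ! i"] i len by simp
    then show "map (\<lambda>i. (b i, \<alpha> (Suc i))) [0..<N] ! i = ps ! i"
      using i by (simp add: b_def points_def prod_eq_iff)
  qed (simp add: len)
  then have "map (\<lambda>i. (b i, \<alpha> (Suc i))) [k..<N] = drop k ps" for k
    by (metis add_0 drop_map drop_upt)
  moreover have "b N - b 0 = c" using N by (simp add: b_def)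
  ultimately have cf: "cf_mat N \<alpha> b k = lprod (drop k ps) c" for k
    by (simp add: cf_mat_def)
  have "snd (column_at True (cf_mat N \<alpha> b k) (\<alpha> (Suc k))) \<noteq> 0" if "k < N" for k
  proof -
    have "\<alpha> (Suc k) \<in> set (points N \<alpha>)" using that by (auto simp: set_points)
    then have "poly (fst (cf_mat N \<alpha> b (Suc k))) (\<alpha> (Suc k)) \<noteq> 0"
      unfolding cf by (intro generic_first_entry[OF generic_drop[OF gen]])
    then show ?thesis
      unfolding cf_mat_step[OF that] column_at_step snd_conv fst_column_at .
  qed
  then have "regular g N \<alpha> (triple_of ?M) (half_trace ?M)"
    by (intro regularI[OF \<alpha> t, of b]) (simp_all add: start_tuple_triple_of cf)
  moreover have "poly (half_trace ?M) (\<alpha> N) \<noteq> 0" "no_common_root (triple_of ?M)"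
    using nd by (cases ?M; auto simp: nondegenerate_def no_common_root_def)+
  ultimately show ?thesis
    using shaped good_fun_iff[OF t(2)] by (simp add: good_mats_def mat_coords_def)
qed

lemma adherent_good_fixed:
  assumes N: "N = 2 * g + 1" and \<alpha>: "alpha_seq N \<alpha>" and ps: "map snd ps = points N \<alpha>"
  shows "lprod ps c \<in> adherent {M \<in> good_mats g N \<alpha>. \<exists>qs. map snd qs = points N \<alpha> \<and> M = lprod qs c}"
proof -
  have "\<alpha> N \<in> set (points N \<alpha>)" using N by (auto simp: set_points)
  moreover have "ps \<noteq> []" using N arg_cong[OF ps, of length] by auto
  ultimately have "lprod ps c \<in> adherent {lprod ps' c | ps'. map snd ps' = map snd ps \<and>
      generic (set (points N \<alpha>)) ps' c \<and> nondegenerate (\<alpha> N) (lprod ps' c)}"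
    using ps by (intro adherent_nondegenerate) auto
  moreover have "{lprod ps' c | ps'. map snd ps' = map snd ps \<and>
      generic (set (points N \<alpha>)) ps' c \<and> nondegenerate (\<alpha> N) (lprod ps' c)} \<subseteq>
      {M \<in> good_mats g N \<alpha>. \<exists>qs. map snd qs = points N \<alpha> \<and> M = lprod qs c}"
  proof
    fix L assume "L \<in> {lprod ps' c | ps'. map snd ps' = map snd ps \<and>
      generic (set (points N \<alpha>)) ps' c \<and> nondegenerate (\<alpha> N) (lprod ps' c)}"
    then obtain qs where qs: "L = lprod qs c" "map snd qs = map snd ps"
        "generic (set (points N \<alpha>)) qs c" "nondegenerate (\<alpha> N) (lprod qs c)"
      by blast
    then have "L \<in> good_mats g N \<alpha>"
      unfolding qs(1) by (intro lprod_in_good_mats[OF N \<alpha>]) (simp_all add: ps)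
    then show "L \<in> {M \<in> good_mats g N \<alpha>. \<exists>qs. map snd qs = points N \<alpha> \<and> M = lprod qs c}"
      using qs(1,2) ps by auto
  qed
  ultimately show ?thesis by (rule adherent_weaken)
qed

lemma shaped_adherent_good:
  assumes N: "N = 2 * g + 1" and \<alpha>: "alpha_seq N \<alpha>"
  shows "shaped (points N \<alpha>) \<subseteq> adherent (good_mats g N \<alpha>)"
proof -
  have "lprods (points N \<alpha>) \<subseteq> adherent (good_mats g N \<alpha>)"
  proof
    fix L assume "L \<in> lprods (points N \<alpha>)"
    then obtain ps c where L: "L = lprod ps c" "map snd ps = points N \<alpha>" by (rule lprodsE)
    show "L \<in> adherent (good_mats g N \<alpha>)"
      unfolding L(1) by (rule adherent_weaken[OF adherent_good_fixed[OF N \<alpha> L(2)]]) auto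
  qed
  then show ?thesis
    using subset_trans[OF shaped_subset_adherent[OF distinct_points[OF \<alpha>]] adherent_subset] by blast
qed

text \<open>On start matrices, \<open>flip\<close> replaces \<open>T\<close> by \<open>- T\<close>.\<close>

fun flip :: "mat2 \<Rightarrow> mat2" where
  "flip (p, q, r, s) = (- s, q, r, - p)"

lemma flip_flip [simp]: "flip (flip M) = M"
  by (cases M) simp

lemma triple_of_flip [simp]: "triple_of (flip M) = triple_of M"
  by (cases M) simp

lemma half_trace_flip [simp]: "half_trace (flip M) = - half_trace M"
  by (cases M) (simp add: smult_add_right smult_diff_right)

lemma near_flip: "near e M M' \<Longrightarrow> near e (flip M) (flip M')"
  by (cases M; cases M') (auto simp: near_poly_def norm_minus_commute)

lemma procedure_root_uminus: "procedure_root g N \<alpha> t T \<Longrightarrow> procedure_root g N \<alpha> t (- T)"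
  by (simp add: procedure_root_def)

lemma flip_in_shaped:
  assumes "N = 2 * g + 1" "M \<in> shaped (points N \<alpha>)"
  shows "flip M \<in> shaped (points N \<alpha>)"
  using start_tuple_in_shaped_iff[OF assms(1), of "triple_of (flip M)" "half_trace (flip M)" \<alpha>]
    shaped_triple_of[OF assms] procedure_root_uminus
  by (simp add: start_tuple_triple_of del: triple_of_flip half_trace_flip) simp

text \<open>Nonvanishing of \<open>good_fun\<close> is open, so a good M1 near M has a good
  neighbourhood. A good M2 close to \<open>flip M1\<close> then makes \<open>flip M2\<close> good as
  well, since it lies in that neighbourhood and has the same triple as M2.\<close>

lemma adherent_good_both:
  assumes N: "N = 2 * g + 1" and \<alpha>: "alpha_seq N \<alpha>" and M: "M \<in> shaped (points N \<alpha>)"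
  shows "M \<in> adherent {M \<in> good_mats g N \<alpha>. flip M \<in> good_mats g N \<alpha>}"
  unfolding adherent_def
proof (intro CollectI allI impI)
  fix e :: real assume "e > 0"
  then have e2: "e / 2 > 0" by simp
  obtain M1 where M1: "M1 \<in> good_mats g N \<alpha>" "near (e / 2) M1 M"
    using adherentD[OF subsetD[OF shaped_adherent_good[OF N \<alpha>] M] e2] by blast
  then have M1_shaped: "M1 \<in> shaped (points N \<alpha>)" and "good_fun g N (mat_coords \<alpha> M1) \<noteq> 0"
    by (auto simp: good_mats_def)
  from near_neq_0[OF polynomial_fun_good_fun this(2)]
  obtain d where d: "d > 0" "\<And>M'. near d M' M1 \<Longrightarrow> good_fun g N (mat_coords \<alpha> M') \<noteq> 0" by blast
  have "min d (e / 2) > 0" using d(1) e2 by simp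
  from adherentD[OF subsetD[OF shaped_adherent_good[OF N \<alpha>] flip_in_shaped[OF N M1_shaped]] this]
  obtain M2 where M2: "M2 \<in> good_mats g N \<alpha>" "near (min d (e / 2)) M2 (flip M1)" by blast
  have near: "near (min d (e / 2)) (flip M2) M1"
    using near_flip[OF M2(2)] by simp
  have mono: "near a L L' \<Longrightarrow> a \<le> b \<Longrightarrow> near b L L'" for a b L L'
    by (cases L; cases L') (auto intro: near_poly_mono)
  have "flip M2 \<in> good_mats g N \<alpha>"
    using M2(1) d(2)[OF mono[OF near]] flip_in_shaped[OF N, of M2 \<alpha>] by (simp add: good_mats_def)
  moreover have "near e (flip M2) M"
    using near_trans[OF mono[OF near, of "e / 2"] M1(2)] by simp
  ultimately show "\<exists>M'\<in>{M \<in> good_mats g N \<alpha>. flip M \<in> good_mats g N \<alpha>}. near e M' M"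
    using M2(1) by (intro bexI[of _ "flip M2"]) auto
qed

lemma procedure_root_unique:
  assumes "procedure_root g N \<alpha> t T" "procedure_root g N \<alpha> t T'"
  shows "T' = T \<or> T' = - T"
proof -
  have "T' ^ 2 = T ^ 2" using assms by (simp add: procedure_root_def)
  then show ?thesis by (simp add: power2_eq_iff)
qed

lemma procedure_root_exists:
  assumes "t \<in> triples g N \<alpha>"
  obtains T where "procedure_root g N \<alpha> t T"
  using assms that by (auto simp: triples_def alpha_admissible_def procedure_root_def)

lemma triple_dense:
  assumes "M \<in> adherent S" "\<And>M'. M' \<in> S \<Longrightarrow> triple_of M' \<in> U"
  shows "\<exists>Y. (\<forall>k. Y k \<in> U) \<and> triple_tendsto Y (triple_of M)"
proof -
  obtain F where F: "\<And>k. F k \<in> S"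
      "\<And>v. (\<lambda>k. mat_coords (\<lambda>_. 0) (F k) v) \<longlonglongrightarrow> mat_coords (\<lambda>_. 0) M v"
    using adherent_sequence[OF assms(1), of "\<lambda>_. 0"] by blast
  then show ?thesis
    using assms(2) triple_tendsto_mat[OF F(2)] by (intro exI[of _ "\<lambda>k. triple_of (F k)"]) auto
qed

text \<open>K selects the roots T on which the conditions are imposed: the zero function selects
  both roots, \<open>pure_sign\<close> those with T(\<alpha>_N) = - B(\<alpha>_N).\<close>

definition good_set ::
    "nat \<Rightarrow> nat \<Rightarrow> (nat \<Rightarrow> complex) \<Rightarrow> triple set \<Rightarrow> ((coord \<Rightarrow> complex) \<Rightarrow> complex) \<Rightarrow> triple set" where
  "good_set g N \<alpha> V K = {t \<in> V. no_common_root t} \<inter>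
     {t \<in> V. \<forall>T. procedure_root g N \<alpha> t T \<longrightarrow> K (coord_values \<alpha> t T) = 0 \<longrightarrow>
       good_fun g N (coord_values \<alpha> t T) \<noteq> 0}"

lemma openin_good_set:
  assumes "V \<subseteq> triples g N \<alpha>" "polynomial_fun K"
  shows "openin (coeff_topology V) (good_set g N \<alpha> V K)"
  unfolding good_set_def
  by (intro openin_Int openin_no_common_root[OF assms(1)]
      openin_all_roots[OF assms(1) polynomial_fun_good_fun assms(2)])

lemma open_dense_all:
  assumes N: "N = 2 * g + 1" and \<alpha>: "alpha_seq N \<alpha>"
  shows "open_dense_in (good_set g N \<alpha> (triples g N \<alpha>) (\<lambda>_. 0)) (triples g N \<alpha>)"
  unfolding open_dense_in_def
proof (intro conjI openin_good_set dense_coeff_topologyI)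
  fix t assume t: "t \<in> triples g N \<alpha>"
  then obtain T where T: "procedure_root g N \<alpha> t T" by (rule procedure_root_exists)
  have "start_tuple t T \<in> shaped (points N \<alpha>)"
    using start_tuple_in_shaped_iff[OF N] t T by blast
  from triple_dense[OF adherent_good_both[OF N \<alpha> this], of "good_set g N \<alpha> (triples g N \<alpha>) (\<lambda>_. 0)"]
  show "\<exists>Y. (\<forall>k. Y k \<in> good_set g N \<alpha> (triples g N \<alpha>) (\<lambda>_. 0)) \<and> triple_tendsto Y t"
  proof (simp, elim meta_mp)
    fix M assume "M \<in> good_mats g N \<alpha> \<and> flip M \<in> good_mats g N \<alpha>"
    then have M: "M \<in> shaped (points N \<alpha>)" "no_common_root (triple_of M)"
        "good_fun g N (coord_values \<alpha> (triple_of M) (half_trace M)) \<noteq> 0"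
        "good_fun g N (coord_values \<alpha> (triple_of M) (- half_trace M)) \<noteq> 0"
      by (auto simp: good_mats_def mat_coords_def)
    note tM = shaped_triple_of[OF N M(1)]
    have "good_fun g N (coord_values \<alpha> (triple_of M) T) \<noteq> 0"
      if "procedure_root g N \<alpha> (triple_of M) T" for T
      using procedure_root_unique[OF tM(2) that] M(3,4) by auto
    then show "triple_of M \<in> good_set g N \<alpha> (triples g N \<alpha>) (\<lambda>_. 0)"
      using tM(1) M(2) by (auto simp: good_set_def)
  qed
qed (auto simp: good_set_def intro: polynomial_fun.intros)

section \<open>The pure periodic case\<close>

text \<open>Right multiplication by the step matrix with \<open>b = 0\<close>: it closes a pure periodic product.\<close>

fun append_zero :: "complex \<Rightarrow> mat2 \<Rightarrow> mat2" where
  "append_zero x (p, q, r, s) = (q, lin x * p, s, lin x * r)"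

lemma append_zero_step: "append_zero x (step b y M) = step b y (append_zero x M)"
  by (cases M) (simp add: algebra_simps)

text \<open>The final matrix with rows (1, c) and (0, 1) times the appended factor is the step
  matrix with coefficient c, so c turns into an ordinary coefficient and the new final constant is
  0.\<close>

lemma append_zero_lprod: "append_zero x (lprod ps c) = lprod (ps @ [(c, x)]) 0"
proof (induction ps)
  case (Cons bx ps)
  then show ?case by (cases bx) (simp add: append_zero_step)
qed simp

lemma near_append_zero:
  assumes "e > 0" "near e M M'"
  shows "near ((1 + norm x) * e) (append_zero x M) (append_zero x M')"
proof -
  have le: "e \<le> (1 + norm x) * e" using assms(1) by (simp add: algebra_simps)
  have "near_poly ((1 + norm x) * e) (lin x * f) (lin x * f')" if "near_poly e f f'" for f f'
    using near_poly_step[OF assms(1) near_poly_refl[OF assms(1), of 0] that, of 0 x] by simp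
  then show ?thesis
    using assms(2) near_poly_mono[OF _ le] by (cases M; cases M') simp
qed

lemma adherent_append_zero:
  assumes "M \<in> adherent S"
  shows "append_zero x M \<in> adherent (append_zero x ` S)"
  unfolding adherent_def
proof (intro CollectI allI impI)
  fix e :: real assume e: "e > 0"
  have K: "1 + norm x > 0" by (simp add: add_pos_nonneg)
  then have "e / (1 + norm x) > 0" using e by simp
  then obtain M' where "M' \<in> S" "near (e / (1 + norm x)) M' M"
    using adherentD[OF assms] by blast
  then show "\<exists>M'\<in>append_zero x ` S. near e M' (append_zero x M)"
    using near_append_zero[OF \<open>e / (1 + norm x) > 0\<close>, of M' M x] K by auto
qed

lemma points_Suc: "points (Suc n) \<alpha> = points n \<alpha> @ [\<alpha> (Suc n)]"
  by (simp add: points_def)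

text \<open>Dividing the second column by the linear factor and swapping the columns undoes
  \<open>append_zero\<close>. The swap matches the change of parity in the shape when one parameter
  is removed.\<close>

lemma shaped_append_zeroE:
  assumes M: "(p, q, r, s) \<in> shaped (points (2 * g + 1) \<alpha>)"
    and z: "poly q (\<alpha> (2 * g + 1)) = 0" "poly s (\<alpha> (2 * g + 1)) = 0"
  obtains M' where "M' \<in> shaped (points (2 * g) \<alpha>)" "(p, q, r, s) = append_zero (\<alpha> (2 * g + 1)) M'"
proof -
  let ?x = "\<alpha> (2 * g + 1)"
  obtain q' s' where qs: "q = lin ?x * q'" "s = lin ?x * s'"
    using z by (auto simp: lin_dvd_iff[symmetric] elim!: dvdE)
  have rows: "row_shape (Suc (2 * g + 1)) p q" "row_shape (2 * g + 1) r s"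
    and det: "det2 (p, q, r, s) = (\<Prod>x\<leftarrow>points (2 * g + 1) \<alpha>. - lin x)"
    using M by (simp_all add: shaped_def)
  have q: "poly.coeff q (Suc g) = 1" "\<forall>i>Suc g. poly.coeff q i = 0" "\<forall>i>g. poly.coeff p i = 0"
    and r: "poly.coeff r g = 1" "\<forall>i>g. poly.coeff r i = 0" "\<forall>i>g. poly.coeff s i = 0"
    using rows by (auto simp: row_shape_def Suc_le_eq)
  have q': "\<forall>i\<ge>Suc g. poly.coeff q' i = 0" and s': "\<forall>i\<ge>g. poly.coeff s' i = 0"
    using q(2) r(3) unfolding qs using lin_mult_coeff_vanish by blast+
  then have "poly.coeff q' g = 1"
    using q(1) unfolding qs coeff_lin_mult_Suc by simp
  then have "row_shape (Suc (2 * g)) q' p" "row_shape (2 * g) s' r"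
    using q q' r s' by (auto simp: row_shape_def Suc_le_eq)
  moreover have "- lin ?x * det2 (q', p, s', r) = - lin ?x * (\<Prod>x\<leftarrow>points (2 * g) \<alpha>. - lin x)"
    using det unfolding qs by (simp add: points_Suc algebra_simps)
  then have "det2 (q', p, s', r) = (\<Prod>x\<leftarrow>points (2 * g) \<alpha>. - lin x)"
    by (metis lin_neq_0 mult_cancel_left neg_equal_0_iff_equal)
  ultimately have "(q', p, s', r) \<in> shaped (points (2 * g) \<alpha>)"
    by (simp add: shaped_def)
  then show ?thesis using that qs by simp
qed

lemma lprod_zero_last:
  assumes "map snd ps = points (2 * g + 1) \<alpha>"
  shows "column_at False (lprod ps 0) (\<alpha> (2 * g + 1)) = (0, 0)"
proof -
  have "map snd ps = points (2 * g) \<alpha> @ [\<alpha> (2 * g + 1)]"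
    using assms by (simp add: points_Suc)
  then obtain qs b where ps: "ps = qs @ [(b, \<alpha> (2 * g + 1))]"
    by (auto simp: map_eq_append_conv)
  show ?thesis
    unfolding ps append_zero_lprod[symmetric] by (cases "lprod qs b") simp
qed

definition pure_triples :: "nat \<Rightarrow> nat \<Rightarrow> (nat \<Rightarrow> complex) \<Rightarrow> triple set" where
  "pure_triples g N \<alpha> = {(A, B, C). (A, B, C) \<in> triples g N \<alpha> \<and> poly C (\<alpha> N) = 0}"

definition pure_sign :: "nat \<Rightarrow> nat \<Rightarrow> (coord \<Rightarrow> complex) \<Rightarrow> complex" where
  "pure_sign g N x = eval_coords (g + 1) x Coord_T N + eval_coords (g + 1) x Coord_B N"

lemma pure_sign_eq:
  assumes "(A, B, C) \<in> triples g N \<alpha>" "procedure_root g N \<alpha> (A, B, C) T"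
  shows "pure_sign g N (coord_values \<alpha> (A, B, C) T) = poly T (\<alpha> N) + poly B (\<alpha> N)"
  using assms unfolding pure_sign_def
  by (subst eval_coords_T eval_coords_B; auto simp: triples_def procedure_root_def)+

text \<open>At \<alpha>_N both C and \<open>alpha_poly N \<alpha>\<close> vanish, so T^2 = B^2 there
  and one of T and - T has the required value.\<close>

lemma pure_root_exists:
  assumes N: "N = 2 * g + 1" and t: "(A, B, C) \<in> triples g N \<alpha>" "poly C (\<alpha> N) = 0"
  obtains T where "procedure_root g N \<alpha> (A, B, C) T" "poly T (\<alpha> N) = - poly B (\<alpha> N)"
proof -
  obtain T where T: "procedure_root g N \<alpha> (A, B, C) T" using procedure_root_exists[OF t(1)] .
  have "poly (alpha_poly N \<alpha>) (\<alpha> N) = 0"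
    using N by (auto simp: alpha_poly_def poly_prod)
  then have "poly (T ^ 2) (\<alpha> N) = poly B (\<alpha> N) ^ 2"
    using T t(2) by (simp add: procedure_root_def)
  then have "poly T (\<alpha> N) = poly B (\<alpha> N) \<or> poly T (\<alpha> N) = - poly B (\<alpha> N)"
    by (simp add: power2_eq_iff)
  then show ?thesis
    using that T procedure_root_uminus[OF T] by auto
qed

text \<open>Approximants must satisfy C(\<alpha>_N) = 0 as well. For the root with T = - B at
  \<alpha>_N the second column of the start matrix vanishes there, so the matrix comes by
  \<open>append_zero\<close> from one with a parameter less. Approximating that one, and perturbing
  the result with c = 0 fixed, stays among the pure triples.\<close>

lemma open_dense_pure:
  assumes N: "N = 2 * g + 1" and \<alpha>: "alpha_seq N \<alpha>"
  shows "open_dense_in (good_set g N \<alpha> (pure_triples g N \<alpha>) (pure_sign g N)) (pure_triples g N \<alpha>)"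
  unfolding open_dense_in_def
proof (intro conjI openin_good_set dense_coeff_topologyI)
  show "polynomial_fun (pure_sign g N)"
    unfolding pure_sign_def by (intro polynomial_fun.add polynomial_fun_eval_coords)
  fix t assume "t \<in> pure_triples g N \<alpha>"
  then obtain A B C where t: "t = (A, B, C)" "(A, B, C) \<in> triples g N \<alpha>" "poly C (\<alpha> N) = 0"
    by (auto simp: pure_triples_def)
  obtain T where T: "procedure_root g N \<alpha> (A, B, C) T" "poly T (\<alpha> N) = - poly B (\<alpha> N)"
    using pure_root_exists[OF N t(2,3)] .
  let ?M = "start_tuple (A, B, C) T"
  let ?S = "{M \<in> good_mats g N \<alpha>. \<exists>qs. map snd qs = points N \<alpha> \<and> M = lprod qs 0}"
  have "?M \<in> shaped (points N \<alpha>)"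
    using start_tuple_in_shaped_iff[OF N] t(2) T(1) by blast
  then have "(T - B, - C, A, T + B) \<in> shaped (points (2 * g + 1) \<alpha>)"
    "poly (- C) (\<alpha> (2 * g + 1)) = 0" "poly (T + B) (\<alpha> (2 * g + 1)) = 0"
    using t(3) T(2) N by simp_all
  then obtain M' where "M' \<in> shaped (points (2 * g) \<alpha>)"
      "(T - B, - C, A, T + B) = append_zero (\<alpha> (2 * g + 1)) M'"
    by (rule shaped_append_zeroE)
  then have M': "M' \<in> shaped (points (2 * g) \<alpha>)" "?M = append_zero (\<alpha> N) M'"
    using N by simp_all
  have "distinct (points (2 * g) \<alpha>)"
    using distinct_points[OF \<alpha>] N by (simp add: points_Suc)
  then have "M' \<in> adherent (lprods (points (2 * g) \<alpha>))"
    using shaped_subset_adherent M'(1) by blast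
  then have "?M \<in> adherent (append_zero (\<alpha> N) ` lprods (points (2 * g) \<alpha>))"
    unfolding M'(2) by (rule adherent_append_zero)
  moreover have "append_zero (\<alpha> N) ` lprods (points (2 * g) \<alpha>) \<subseteq> adherent ?S"
  proof
    fix L assume "L \<in> append_zero (\<alpha> N) ` lprods (points (2 * g) \<alpha>)"
    then obtain L' where "L = append_zero (\<alpha> N) L'" "L' \<in> lprods (points (2 * g) \<alpha>)" by blast
    then obtain ps c where "L = append_zero (\<alpha> N) (lprod ps c)" "map snd ps = points (2 * g) \<alpha>"
      by (metis lprodsE)
    then have "L = lprod (ps @ [(c, \<alpha> N)]) 0" "map snd (ps @ [(c, \<alpha> N)]) = points N \<alpha>"
      using N by (simp_all add: append_zero_lprod points_Suc)
    then show "L \<in> adherent ?S" using adherent_good_fixed[OF N \<alpha>] by simp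
  qed
  ultimately have adh: "?M \<in> adherent ?S" using adherent_subset by blast
  have good: "triple_of M \<in> good_set g N \<alpha> (pure_triples g N \<alpha>) (pure_sign g N)" if M: "M \<in> ?S" for M
  proof -
    obtain A' B' C' where t': "triple_of M = (A', B', C')" by (cases "triple_of M")
    define T' where "T' = half_trace M"
    have M_eq: "M = start_tuple (A', B', C') T'"
      unfolding T'_def t'[symmetric] start_tuple_triple_of ..
    have shaped: "M \<in> shaped (points N \<alpha>)" and ncr: "no_common_root (A', B', C')"
      and good: "good_fun g N (coord_values \<alpha> (A', B', C') T') \<noteq> 0"
      using M by (auto simp: good_mats_def mat_coords_def t' T'_def)
    have tr: "(A', B', C') \<in> triples g N \<alpha>" "procedure_root g N \<alpha> (A', B', C') T'"
      using shaped_triple_of[OF N shaped] by (simp_all add: t' T'_def)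
    obtain qs where "map snd qs = points N \<alpha>" "M = lprod qs 0" using M by blast
    then have "column_at False M (\<alpha> N) = (0, 0)"
      using lprod_zero_last[of qs g \<alpha>] N by simp
    then have z: "poly C' (\<alpha> N) = 0" "poly T' (\<alpha> N) + poly B' (\<alpha> N) = 0"
      by (simp_all add: M_eq)
    have T'nz: "poly T' (\<alpha> N) \<noteq> 0"
      using good good_fun_iff[OF tr(2)] by blast
    have "good_fun g N (coord_values \<alpha> (A', B', C') T2) \<noteq> 0"
      if T2: "procedure_root g N \<alpha> (A', B', C') T2" "pure_sign g N (coord_values \<alpha> (A', B', C') T2) = 0" for T2
    proof -
      have "poly T2 (\<alpha> N) + poly B' (\<alpha> N) = 0"
        using T2 pure_sign_eq[OF tr(1) T2(1)] by simp
      then have "poly T2 (\<alpha> N) = poly T' (\<alpha> N)" using z(2) by (metis add_right_cancel)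
      \<comment> \<open>Since T' does not vanish at \<alpha>_N, its value there separates it from -
        T', so \<open>pure_sign\<close> leaves only the good root.\<close>
      then have "T2 \<noteq> - T'" using T'nz by auto
      then show ?thesis using procedure_root_unique[OF tr(2) T2(1)] good by auto
    qed
    then show ?thesis
      using tr(1) z(1) ncr by (auto simp: t' good_set_def pure_triples_def)
  qed
  show "\<exists>Y. (\<forall>k. Y k \<in> good_set g N \<alpha> (pure_triples g N \<alpha>) (pure_sign g N)) \<and> triple_tendsto Y t"
    using triple_dense[OF adh good] unfolding triple_of_start_tuple t(1) .
qed (auto simp: good_set_def pure_triples_def)

text \<open>At \<alpha>_N the last step matrix has zero second column, so its product with the final
  matrix has columns (b, 1) and c * (b, 1), where b = b_(N-1) and c = b_N - b_0. The other factors
  are invertible there because the parameters are distinct.\<close>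

lemma columns_at_last:
  assumes \<alpha>: "alpha_seq N \<alpha>" and "N > 0"
  shows "column_at True (cf_mat N \<alpha> b 0) (\<alpha> N) \<noteq> (0, 0) \<and>
    column_at False (cf_mat N \<alpha> b 0) (\<alpha> N) =
      ((b N - b 0) * fst (column_at True (cf_mat N \<alpha> b 0) (\<alpha> N)),
       (b N - b 0) * snd (column_at True (cf_mat N \<alpha> b 0) (\<alpha> N)))"
proof -
  obtain n where n: "N = Suc n" using \<open>N > 0\<close> by (cases N) auto
  have "column_at True (cf_mat N \<alpha> b j) (\<alpha> N) \<noteq> (0, 0) \<and>
    column_at False (cf_mat N \<alpha> b j) (\<alpha> N) =
      ((b N - b 0) * fst (column_at True (cf_mat N \<alpha> b j) (\<alpha> N)),
       (b N - b 0) * snd (column_at True (cf_mat N \<alpha> b j) (\<alpha> N)))" if "j \<le> n" for j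
    using that
  proof (induction j rule: inc_induct)
    case base
    have "cf_mat N \<alpha> b n = step (b n) (\<alpha> N) (1, [:b N - b 0:], 0, 1)"
      using cf_mat_step[of n N \<alpha> b] cf_mat_end[of N \<alpha> b] n by simp
    then show ?case unfolding column_at_step by (simp add: algebra_simps)
  next
    case (step j)
    have "\<alpha> N \<noteq> \<alpha> (Suc j)"
      using \<alpha> step.hyps n inj_onD[of \<alpha> "{1..N}" N "Suc j"] by (auto simp: alpha_seq_def)
    moreover have "j < N" using step.hyps n by simp
    moreover obtain u v where "column_at True (cf_mat N \<alpha> b (Suc j)) (\<alpha> N) = (u, v)" by fastforce
    moreover define c where "c = b N - b 0"
    ultimately show ?case
      using step.IH unfolding cf_mat_step[OF \<open>j < N\<close>] column_at_step c_def[symmetric]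
      by (auto simp: algebra_simps)
  qed
  then show ?thesis by blast
qed

section \<open>Expansions of a function and factorisations of start matrices\<close>

lemma expansion_start_tuple:
  assumes N: "N = 2 * g + 1"
  obtains t T where "cf_mat N \<alpha> b 0 = start_tuple t T" "t \<in> triples g N \<alpha>"
    "procedure_root g N \<alpha> t T"
    "\<And>\<phi>. has_expansion N \<alpha> b \<phi> \<longleftrightarrow> periodic_coeffs N b \<and> represents t \<phi>"
proof -
  obtain t T where tT: "cf_mat N \<alpha> b 0 = start_tuple t T" "t \<in> triples g N \<alpha>"
      "procedure_root g N \<alpha> t T"
    using shaped_start_tuple[OF N cf_mat_in_shaped] .
  have "N > 0" using N by simp
  show ?thesis
    using that[OF tT] has_expansion_iff[OF \<open>N > 0\<close>] fixes_start_tuple_iff[OF tT(2)] tT(1) by simp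
qed

text \<open>With common roots allowed, the given triple may differ from the triple (A', B', C') of
  the expansion. Proportionality still transfers the root: A' * C and B' * C vanish at \<alpha>_N,
  whereas A' or B' does not, the first column there being (- 2 * B', A').\<close>

lemma pure_expansion_root:
  assumes N: "N = 2 * g + 1" and \<alpha>: "alpha_seq N \<alpha>"
    and t: "(A, B, C) \<in> triples g N \<alpha>" "represents (A, B, C) \<phi>"
    and b: "has_pure_expansion N \<alpha> b \<phi>"
  shows "poly C (\<alpha> N) = 0"
proof -
  obtain t' T' where t': "cf_mat N \<alpha> b 0 = start_tuple t' T'" "t' \<in> triples g N \<alpha>"
      "represents t' \<phi>"
    using expansion_start_tuple[OF N, of \<alpha> b] b by (metis has_pure_expansion_def)
  obtain A' B' C' where t'_eq: "t' = (A', B', C')" by (cases t')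
  have "b N - b 0 = 0" using b by (simp add: has_pure_expansion_def)
  moreover have "N > 0" using N by simp
  ultimately have cols: "column_at True (start_tuple (A', B', C') T') (\<alpha> N) \<noteq> (0, 0)"
      "column_at False (start_tuple (A', B', C') T') (\<alpha> N) = (0, 0)"
    using columns_at_last[OF \<alpha>, of b] t'(1) by (auto simp: t'_eq)
  then have nz: "poly A' (\<alpha> N) \<noteq> 0 \<or> poly B' (\<alpha> N) \<noteq> 0" and C': "poly C' (\<alpha> N) = 0"
    by (auto simp: add_eq_0_iff)
  have "A' * C = A * C'" "B' * C = B * C'"
    using quadratics_proportional[OF N t] t'(2,3) unfolding t'_eq by blast+
  then have "poly A' (\<alpha> N) * poly C (\<alpha> N) = 0" "poly B' (\<alpha> N) * poly C (\<alpha> N) = 0"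
    using C' by (metis mult_zero_right poly_mult)+
  then show ?thesis using nz by auto
qed

text \<open>An expansion of \<phi> produces a triple of its own; absence of common roots identifies
  it with t, so only T remains free.\<close>

lemma has_expansion_iff_procedure:
  assumes N: "N = 2 * g + 1" and t: "t \<in> triples g N \<alpha>" "no_common_root t" "represents t \<phi>"
  shows "has_expansion N \<alpha> b \<phi> \<longleftrightarrow> periodic_coeffs N b \<and>
    (\<exists>T. procedure_root g N \<alpha> t T \<and> cf_mat N \<alpha> b 0 = start_tuple t T)"
proof -
  obtain t' T' where t': "cf_mat N \<alpha> b 0 = start_tuple t' T'" "t' \<in> triples g N \<alpha>"
    "procedure_root g N \<alpha> t' T'"
    "\<And>\<phi>. has_expansion N \<alpha> b \<phi> \<longleftrightarrow> periodic_coeffs N b \<and> represents t' \<phi>"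
    using expansion_start_tuple[OF N] by blast
  have "t' = t" if "represents t' \<phi>"
    using that t t'(2) triple_unique[OF N]
    by (cases t; cases t') (auto simp: no_common_root_def)
  then show ?thesis
    using t' t(3) by (auto simp: start_tuple_inject)
qed

theorem theorem1:
  fixes g N :: nat
  assumes "N = 2 * g + 1"
  shows
    "(\<forall>\<alpha> b \<phi>. alpha_seq N \<alpha> \<longrightarrow> has_expansion N \<alpha> b \<phi> \<longrightarrow>
        (\<exists>A B C. (A, B, C) \<in> triples g N \<alpha> \<and> represents (A, B, C) \<phi> \<and>
           of_cpoly A * \<phi> ^ 2 + 2 * of_cpoly B * \<phi> + of_cpoly C = 0))
     \<and>
     (\<exists>P Q. (\<forall>i\<le>N. polynomial_fun (P i) \<and> polynomial_fun (Q i)) \<and>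
        (\<forall>\<alpha>. alpha_seq N \<alpha> \<longrightarrow>
          (\<exists>U. open_dense_in U (triples g N \<alpha>) \<and>
            (\<forall>t\<in>U.
              (\<forall>\<phi>. represents t \<phi> \<longrightarrow>
                 card {b. has_expansion N \<alpha> b \<phi>} = 2 \<and>
                 {b. has_expansion N \<alpha> b \<phi>} =
                   {b. \<exists>T. procedure_root g N \<alpha> t T \<and> procedure_output N \<alpha> t T b}) \<and>
              (\<forall>T. procedure_root g N \<alpha> t T \<longrightarrow>
                 (\<exists>!b. procedure_output N \<alpha> t T b) \<and>
                 (\<forall>b. procedure_output N \<alpha> t T b \<longrightarrow>
                   (\<forall>i\<le>N. Q i (coord_values \<alpha> t T) \<noteq> 0 \<and>
                      b i = P i (coord_values \<alpha> t T) / Q i (coord_values \<alpha> t T))))))))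
     \<and>
     (\<forall>\<alpha>. alpha_seq N \<alpha> \<longrightarrow>
        (\<forall>A B C \<phi> b. (A, B, C) \<in> triples g N \<alpha> \<longrightarrow> represents (A, B, C) \<phi> \<longrightarrow>
           has_pure_expansion N \<alpha> b \<phi> \<longrightarrow> poly C (\<alpha> N) = 0) \<and>
        (\<exists>U. open_dense_in U {(A, B, C). (A, B, C) \<in> triples g N \<alpha> \<and> poly C (\<alpha> N) = 0} \<and>
           (\<forall>t\<in>U. \<forall>\<phi>. represents t \<phi> \<longrightarrow> (\<exists>!b. has_pure_expansion N \<alpha> b \<phi>))))"
proof (intro conjI)
  have N: "N = 2 * g + 1" by (rule assms)
  have "N > 0" using N by simp
  show "\<forall>\<alpha> b \<phi>. alpha_seq N \<alpha> \<longrightarrow> has_expansion N \<alpha> b \<phi> \<longrightarrow>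
      (\<exists>A B C. (A, B, C) \<in> triples g N \<alpha> \<and> represents (A, B, C) \<phi> \<and>
         of_cpoly A * \<phi> ^ 2 + 2 * of_cpoly B * \<phi> + of_cpoly C = 0)"
  proof (intro allI impI)
    fix \<alpha> b \<phi> assume "has_expansion N \<alpha> b \<phi>"
    then obtain t where t: "t \<in> triples g N \<alpha>" "represents t \<phi>"
      using expansion_start_tuple[OF N, of \<alpha> b] by blast
    obtain A B C where t_eq: "t = (A, B, C)" by (cases t)
    have "A \<noteq> 0" using t(1) by (auto simp: t_eq triples_def)
    then show "\<exists>A B C. (A, B, C) \<in> triples g N \<alpha> \<and> represents (A, B, C) \<phi> \<and>
        of_cpoly A * \<phi> ^ 2 + 2 * of_cpoly B * \<phi> + of_cpoly C = 0"
      using t represents_iff unfolding t_eq by blast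
  qed
  show "\<exists>P Q. (\<forall>i\<le>N. polynomial_fun (P i) \<and> polynomial_fun (Q i)) \<and>
        (\<forall>\<alpha>. alpha_seq N \<alpha> \<longrightarrow>
          (\<exists>U. open_dense_in U (triples g N \<alpha>) \<and>
            (\<forall>t\<in>U.
              (\<forall>\<phi>. represents t \<phi> \<longrightarrow>
                 card {b. has_expansion N \<alpha> b \<phi>} = 2 \<and>
                 {b. has_expansion N \<alpha> b \<phi>} =
                   {b. \<exists>T. procedure_root g N \<alpha> t T \<and> procedure_output N \<alpha> t T b}) \<and>
              (\<forall>T. procedure_root g N \<alpha> t T \<longrightarrow>
                 (\<exists>!b. procedure_output N \<alpha> t T b) \<and>
                 (\<forall>b. procedure_output N \<alpha> t T b \<longrightarrow>
                   (\<forall>i\<le>N. Q i (coord_values \<alpha> t T) \<noteq> 0 \<and>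
                      b i = P i (coord_values \<alpha> t T) / Q i (coord_values \<alpha> t T)))))))"
  \<comment> \<open>The parameters enter as coordinates, so the same rational functions serve every
    \<alpha>.\<close>
  proof (rule exI[of _ "coeff_numer g N"], rule exI[of _ "coeff_denom g N"], rule conjI, goal_cases)
    case 1
    then show ?case using polynomial_fun_coeff_numer polynomial_fun_coeff_denom by blast
  next
    case 2
    show ?case
    proof (intro allI impI)
      fix \<alpha> assume \<alpha>: "alpha_seq N \<alpha>"
      let ?U = "good_set g N \<alpha> (triples g N \<alpha>) (\<lambda>_. 0)"
      have main: "(\<forall>\<phi>. represents t \<phi> \<longrightarrow> card {b. has_expansion N \<alpha> b \<phi>} = 2 \<and>
              {b. has_expansion N \<alpha> b \<phi>} =
                {b. \<exists>T. procedure_root g N \<alpha> t T \<and> procedure_output N \<alpha> t T b}) \<and>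
            (\<forall>T. procedure_root g N \<alpha> t T \<longrightarrow> (\<exists>!b. procedure_output N \<alpha> t T b) \<and>
              (\<forall>b. procedure_output N \<alpha> t T b \<longrightarrow>
                (\<forall>i\<le>N. coeff_denom g N i (coord_values \<alpha> t T) \<noteq> 0 \<and>
                  b i = coeff_numer g N i (coord_values \<alpha> t T) / coeff_denom g N i (coord_values \<alpha> t T))))"
        if "t \<in> ?U" for t
      proof -
        have t: "t \<in> triples g N \<alpha>" "no_common_root t" using that by (auto simp: good_set_def)
        have good: "regular g N \<alpha> t T" "poly T (\<alpha> N) \<noteq> 0" if "procedure_root g N \<alpha> t T" for T
          using \<open>t \<in> ?U\<close> that good_fun_iff[OF that] by (auto simp: good_set_def)
        have unique: "\<exists>!b. procedure_output N \<alpha> t T b" if "procedure_root g N \<alpha> t T" for T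
          using regular_unique_expansion[OF N \<alpha> t(1) that good(1)[OF that]]
          by (simp add: procedure_output_iff)
        have coeffs: "coeff_denom g N i (coord_values \<alpha> t T) \<noteq> 0 \<and>
            b i = coeff_numer g N i (coord_values \<alpha> t T) / coeff_denom g N i (coord_values \<alpha> t T)"
          if "procedure_root g N \<alpha> t T" "procedure_output N \<alpha> t T b" "i \<le> N" for T b i
          using expansion_coeffs[OF \<open>N > 0\<close> t(1) that(1) good(1)[OF that(1)] _ that(3)] that(2)
            coeff_denom_neq_0[OF \<open>N > 0\<close> good(1)[OF that(1)]]
          by (simp add: procedure_output_iff)
        have set_eq: "{b. has_expansion N \<alpha> b \<phi>} =
            {b. \<exists>T. procedure_root g N \<alpha> t T \<and> procedure_output N \<alpha> t T b}" if "represents t \<phi>" for \<phi>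
          using has_expansion_iff_procedure[OF N t that] unfolding procedure_output_iff by blast
        have "card {b. \<exists>T. procedure_root g N \<alpha> t T \<and> procedure_output N \<alpha> t T b} = 2"
        proof -
          obtain T where T: "procedure_root g N \<alpha> t T" using procedure_root_exists[OF t(1)] .
          note T' = procedure_root_uminus[OF T]
          obtain b where b: "procedure_output N \<alpha> t T b" "\<And>c. procedure_output N \<alpha> t T c \<Longrightarrow> c = b"
            using unique[OF T] by blast
          obtain b' where b': "procedure_output N \<alpha> t (- T) b'"
              "\<And>c. procedure_output N \<alpha> t (- T) c \<Longrightarrow> c = b'"
            using unique[OF T'] by blast
          \<comment> \<open>Two distinct roots give distinct start matrices, hence distinct
            expansions.\<close>
          have "T \<noteq> - T"
          proof
            assume "T = - T"
            then have "poly T (\<alpha> N) = - poly T (\<alpha> N)" by (metis poly_minus)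
            then show False using good(2)[OF T] by simp
          qed
          then have "b \<noteq> b'"
            using b(1) b'(1) unfolding procedure_output_iff by (metis start_tuple_inject)
          moreover have "{b. \<exists>T. procedure_root g N \<alpha> t T \<and> procedure_output N \<alpha> t T b} = {b, b'}"
            using T T' b b' procedure_root_unique[OF T] by blast
          ultimately show ?thesis by simp
        qed
        then show ?thesis using set_eq unique coeffs by auto
      qed
      show "\<exists>U. open_dense_in U (triples g N \<alpha>) \<and> (\<forall>t\<in>U. (\<forall>\<phi>. represents t \<phi> \<longrightarrow>
              card {b. has_expansion N \<alpha> b \<phi>} = 2 \<and>
              {b. has_expansion N \<alpha> b \<phi>} =
                {b. \<exists>T. procedure_root g N \<alpha> t T \<and> procedure_output N \<alpha> t T b}) \<and>
            (\<forall>T. procedure_root g N \<alpha> t T \<longrightarrow> (\<exists>!b. procedure_output N \<alpha> t T b) \<and>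
              (\<forall>b. procedure_output N \<alpha> t T b \<longrightarrow>
                (\<forall>i\<le>N. coeff_denom g N i (coord_values \<alpha> t T) \<noteq> 0 \<and>
                  b i = coeff_numer g N i (coord_values \<alpha> t T) / coeff_denom g N i (coord_values \<alpha> t T)))))"
        by (rule exI[of _ ?U], rule conjI[OF open_dense_all[OF N \<alpha>]], rule ballI, rule main)
    qed
  qed
  show "\<forall>\<alpha>. alpha_seq N \<alpha> \<longrightarrow>
        (\<forall>A B C \<phi> b. (A, B, C) \<in> triples g N \<alpha> \<longrightarrow> represents (A, B, C) \<phi> \<longrightarrow>
           has_pure_expansion N \<alpha> b \<phi> \<longrightarrow> poly C (\<alpha> N) = 0) \<and>
        (\<exists>U. open_dense_in U {(A, B, C). (A, B, C) \<in> triples g N \<alpha> \<and> poly C (\<alpha> N) = 0} \<and>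
           (\<forall>t\<in>U. \<forall>\<phi>. represents t \<phi> \<longrightarrow> (\<exists>!b. has_pure_expansion N \<alpha> b \<phi>)))"
  proof (intro allI impI, rule conjI, goal_cases)
    case (1 \<alpha>)
    then show ?case using pure_expansion_root[OF N] by blast
  next
    case (2 \<alpha>)
    then have \<alpha>: "alpha_seq N \<alpha>" .
    let ?U = "good_set g N \<alpha> (pure_triples g N \<alpha>) (pure_sign g N)"
    have "\<exists>!b. has_pure_expansion N \<alpha> b \<phi>" if tU: "t \<in> ?U" and rep: "represents t \<phi>" for t \<phi>
    proof -
      obtain A B C where t_eq: "t = (A, B, C)" by (cases t)
      have t: "(A, B, C) \<in> triples g N \<alpha>" "no_common_root t" "poly C (\<alpha> N) = 0"
        using tU by (auto simp: good_set_def pure_triples_def t_eq)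
      obtain T where T: "procedure_root g N \<alpha> (A, B, C) T" "poly T (\<alpha> N) = - poly B (\<alpha> N)"
        using pure_root_exists[OF N t(1,3)] .
      have "pure_sign g N (coord_values \<alpha> (A, B, C) T) = 0"
        using pure_sign_eq[OF t(1) T(1)] T(2) by simp
      then have reg: "regular g N \<alpha> t T" and nz: "poly T (\<alpha> N) \<noteq> 0"
        using tU T(1) good_fun_iff[OF T(1)] by (auto simp: good_set_def t_eq)
      have pure: "has_pure_expansion N \<alpha> b \<phi> \<longleftrightarrow>
          periodic_coeffs N b \<and> cf_mat N \<alpha> b 0 = start_tuple t T" for b
      proof -
        \<comment> \<open>Of the two roots only T makes the second column vanish at \<alpha>_N; - T
          is ruled out by T(\<alpha>_N) \<noteq> 0.\<close>
        have "b N = b 0 \<longleftrightarrow> T' = T"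
          if T': "procedure_root g N \<alpha> t T'" "cf_mat N \<alpha> b 0 = start_tuple t T'" for T'
        proof -
          have "b N = b 0 \<longleftrightarrow> column_at False (cf_mat N \<alpha> b 0) (\<alpha> N) = (0, 0)"
            using columns_at_last[OF \<alpha> \<open>N > 0\<close>, of b] by (auto simp: prod_eq_iff)
          also have "\<dots> \<longleftrightarrow> poly T' (\<alpha> N) = poly T (\<alpha> N)"
            using t(3) unfolding T'(2) t_eq T(2) by (simp add: eq_neg_iff_add_eq_0)
          also have "\<dots> \<longleftrightarrow> T' = T"
            using procedure_root_unique[OF T(1), of T'] T'(1) nz unfolding t_eq by auto
          finally show ?thesis .
        qed
        then show ?thesis
          using has_expansion_iff_procedure[OF N t(1)[folded t_eq] t(2) rep, of b] T(1)
          unfolding has_pure_expansion_def t_eq by blast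
      qed
      show ?thesis
        unfolding pure using regular_unique_expansion[OF N \<alpha> t(1) T(1)] reg unfolding t_eq by blast
    qed
    then show ?case
      using open_dense_pure[OF N \<alpha>] unfolding pure_triples_def by blast
  qed
qed

end
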